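(* For every integer $k$ with $0\le k\le 11$, there exist collections of partitions $\mathcal{C}_\mu$, indexed by the partitions $\mu\in\mathrm{Par}(k)$, and an involution $\mu\mapsto\mu^*$ on $\mathrm{Par}(k)$, such that: (a) the collections $\mathcal{C}_\mu$ are pairwise disjoint; (b) for all $\gamma\in\mathcal{C}_\mu$, $\mathrm{defc}(\gamma)=|\mu|=k$; (c) each $\mathcal{C}_\mu$ has the form $\{C_\mu(a),C_\mu(a+1),C_\mu(a+2),\ldots\}$, where $a=\ell(\mu^* )$ and $\mathrm{dinv}(C_\mu(i))=i$ for all $i\ge a$; (d) every $\gamma\in\mathrm{Def}(k)$ belongs to $\mathcal{C}_\mu$ for some $\mu\in\mathrm{Par}(k)$; (e) for all $\mu\in\mathrm{Par}(k)$, $\mathrm{tail}(\mu)\subseteq\mathcal{C}_\mu$; (f) for all $\gamma\in\mathcal{C}_\mu$, if $\nu(\gamma)$ is defined then $\nu(\gamma)\in\mathcal{C}_\mu$; (g) for all $n\ge 0$ and all $\mu\in\mathrm{Par}(k)$, $\mathrm{Cat}_{n,\mathcal{C}_\mu}(q,t)=\mathrm{Cat}_{n,\mathcal{C}_{\mu^*}}(t,q)$.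
   Context: **Partitions and statistics.** An integer partition $\gamma=(\gamma_1\ge\cdots\ge\gamma_s>0)$ (possibly empty) has length $\ell(\gamma)=s$, size $|\gamma|=\sum\gamma_i$, $\gamma_i=0$ for $i>s$; zero parts may be appended without changing the partition. Its diagram is the set of cells $(i,j)$ with $1\le i\le \ell(\gamma)$, $1\le j\le\gamma_i$; $\gamma'$ is the conjugate. For a cell $c=(i,j)$, $\mathrm{arm}(c)=\gamma_i-j$ and $\mathrm{leg}(c)=\gamma'_j-i$. $\mathrm{dinv}(\gamma)$ is the number of cells $c$ with $\mathrm{arm}(c)-\mathrm{leg}(c)\in\{0,1\}$; $\mathrm{defc}(\gamma)=|\gamma|-\mathrm{dinv}(\gamma)$. $\min_\Delta(\gamma)$ is the least positive integer $n$ such that $\gamma_i\le n-i$ for $1\le i\le\ell(\gamma)$ (i.e. the diagram fits inside that of $(n-1,n-2,\ldots,1)$). $\mathrm{Par}(k)$ is the set of partitions of size $k$, $\mathrm{Def}(k)$ the set of partitions with $\mathrm{defc}=k$, and $\mathrm{DP}(n)=\{\gamma:\min_\Delta(\gamma)\le n\}$. For a set $\mathcal{S}$ of partitions, $$\mathrm{Cat}_{n,\mathcal{S}}(q,t)=\sum_{\gamma\in\mathcal{S}\cap\mathrm{DP}(n)}q^{\binom n2-|\gamma|}t^{\mathrm{dinv}(\gamma)}.$$ **The map $\nu$.** $\nu$ is defined on partitions $\gamma$ with $\gamma_1\le\ell(\gamma)+2$ by $\nu(\gamma)=(\ell(\gamma)+1,\gamma_1-1,\ldots,\gamma_{\ell(\gamma)}-1)$.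 It is injective, raises dinv by 1 and preserves defc. **Tails.** For a nonempty partition $\mu$ with $n_i$ parts equal to $i$, put $N=\mu_1+\ell(\mu)+1$ and let $v=(v_1,\ldots,v_N)=(0,0,1^{n_1},0,1^{n_2},0,\ldots,0,1^{n_{\mu_1}})$ ($1^{r}$ denotes $r$ copies of $1$). Then $\mathrm{TI}(\mu)=(N-1-v_N,\,N-2-v_{N-1},\ldots,1-v_2,\,0-v_1)$; for $\mu$ empty, $\mathrm{TI}(\mu)$ is the empty partition. It is known that $\nu^m(\mathrm{TI}(\mu))$ is defined for all $m\ge0$. Set $\mathrm{tail}(\mu)=\{\nu^m(\mathrm{TI}(\mu)):m\ge0\}$. *)

theory Defs
  imports "HOL-Library.Disjoint_Sets" "HOL-Computational_Algebra.Polynomial"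
begin

text \<open>Partitions are weakly decreasing lists of positive naturals, so every partition has
  exactly one representative; constructions that may produce trailing zero parts drop them.\<close>

definition is_partition :: "nat list \<Rightarrow> bool" where
  "is_partition \<gamma> \<longleftrightarrow> sorted_wrt (\<ge>) \<gamma> \<and> (\<forall>x\<in>set \<gamma>. x > 0)"

definition drop_zeros :: "nat list \<Rightarrow> nat list" where
  "drop_zeros = filter (\<lambda>x. x > 0)"

text \<open>Part indices start at 1, as usual for partitions.\<close>

definition part :: "nat list \<Rightarrow> nat \<Rightarrow> nat" where
  "part \<gamma> i = (if 1 \<le> i \<and> i \<le> length \<gamma> then \<gamma> ! (i - 1) else 0)"

abbreviation psize :: "nat list \<Rightarrow> nat" where
  "psize \<gamma> \<equiv> sum_list \<gamma>"

definition diagram :: "nat list \<Rightarrow> (nat \<times> nat) set" where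
  "diagram \<gamma> = {(i, j). 1 \<le> i \<and> i \<le> length \<gamma> \<and> 1 \<le> j \<and> j \<le> part \<gamma> i}"

definition conjugate :: "nat list \<Rightarrow> nat list" where
  "conjugate \<gamma> = map (\<lambda>j. length (filter (\<lambda>x. j \<le> x) \<gamma>)) [1..<Suc (part \<gamma> 1)]"

definition arm :: "nat list \<Rightarrow> nat \<times> nat \<Rightarrow> int" where
  "arm \<gamma> = (\<lambda>(i, j). int (part \<gamma> i) - int j)"

definition leg :: "nat list \<Rightarrow> nat \<times> nat \<Rightarrow> int" where
  "leg \<gamma> = (\<lambda>(i, j). int (part (conjugate \<gamma>) j) - int i)"

definition dinv :: "nat list \<Rightarrow> nat" where
  "dinv \<gamma> = card {c \<in> diagram \<gamma>. arm \<gamma> c - leg \<gamma> c \<in> {0, 1}}"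

definition defc :: "nat list \<Rightarrow> int" where
  "defc \<gamma> = int (psize \<gamma>) - int (dinv \<gamma>)"

text \<open>The condition \<open>\<gamma>\<^sub>i \<le> n - i\<close> is written without subtraction.\<close>

definition min_Delta :: "nat list \<Rightarrow> nat" where
  "min_Delta \<gamma> = (LEAST n. 0 < n \<and> (\<forall>i\<in>{1..length \<gamma>}. part \<gamma> i + i \<le> n))"

definition Par :: "nat \<Rightarrow> nat list set" where
  "Par k = {\<gamma>. is_partition \<gamma> \<and> psize \<gamma> = k}"

definition Def :: "nat \<Rightarrow> nat list set" where
  "Def k = {\<gamma>. is_partition \<gamma> \<and> defc \<gamma> = int k}"

definition DP :: "nat \<Rightarrow> nat list set" where
  "DP n = {\<gamma>. is_partition \<gamma> \<and> min_Delta \<gamma> \<le> n}"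

text \<open>The natural subtraction in the exponent never truncates, since the diagram of a member of
  \<open>DP n\<close> fits inside that of \<open>(n - 1, \<dots>, 1)\<close>; for the same reason the sum is finite.
  The arguments \<open>q\<close> and \<open>t\<close> may be elements of any commutative semiring; the polynomial itself is
  obtained at the indeterminates \<open>var_q\<close> and \<open>var_t\<close> of the ring of integer polynomials in two
  variables.\<close>

definition Cat :: "nat \<Rightarrow> nat list set \<Rightarrow> 'a::comm_semiring_1 \<Rightarrow> 'a \<Rightarrow> 'a" where
  "Cat n S q t = (\<Sum>\<gamma>\<in>S \<inter> DP n. q ^ ((n choose 2) - psize \<gamma>) * t ^ dinv \<gamma>)"

definition var_q :: "int poly poly" where
  "var_q = [:[:0, 1:]:]"

definition var_t :: "int poly poly" where
  "var_t = [:0, 1:]"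

definition nu :: "nat list \<Rightarrow> nat list option" where
  "nu \<gamma> = (if part \<gamma> 1 \<le> length \<gamma> + 2
           then Some (drop_zeros ((length \<gamma> + 1) # map (\<lambda>x. x - 1) \<gamma>))
           else None)"

definition TI_vec :: "nat list \<Rightarrow> nat list" where
  "TI_vec \<mu> = 0 # concat (map (\<lambda>i. 0 # replicate (count_list \<mu> i) 1) [1..<Suc (part \<mu> 1)])"

text \<open>For nonempty \<open>\<mu>\<close> the list \<open>TI_vec \<mu>\<close> has length \<open>\<mu>\<^sub>1 + \<ell>(\<mu>) + 1\<close>, and its entries are at most 1
  with the first two equal to 0, so the subtractions in \<open>TI\<close> do not truncate.\<close>

definition TI :: "nat list \<Rightarrow> nat list" where
  "TI \<mu> = (if \<mu> = [] then [] else
     (let N = part \<mu> 1 + length \<mu> + 1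
      in drop_zeros (map (\<lambda>i. i - 1 - part (TI_vec \<mu>) i) (rev [1..<Suc N]))))"

definition tail :: "nat list \<Rightarrow> nat list set" where
  "tail \<mu> = {\<gamma>. \<exists>m. ((\<lambda>x. Option.bind x nu) ^^ m) (Some (TI \<mu>)) = Some \<gamma>}"

end

theory Submission imports Defs begin

text \<open>Prepending a largest part \<open>p\<close> to a partition \<open>\<gamma>\<close> adds one row of cells and changes no arm or leg of an
  old cell. The number of new dinv cells depends only on the parts of \<open>\<gamma>\<close> (\<open>hits\<close>, lemma \<open>dinv_Cons\<close>), so
  dinv and the deficit are sums over the rows. From this form it follows that \<open>nu\<close> raises dinv by one
  (\<open>dinv_nu\<close>). Every partition therefore lies in the \<open>nu\<close>-orbit of exactly one partition outside
  the image of \<open>nu\<close>; these \<open>initial\<close> partitions are the empty one and those whose first part is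
  smaller than their length, and the deficit is constant along an orbit. A chain for \<open>\<mu>\<close> is
  a union of finite orbits followed by the orbit of \<open>TI \<mu>\<close>, which makes disjointness, closure under \<open>nu\<close>
  and the inclusion of the tail immediate. What remains is to know all orbits of deficit \<open>k\<close> and
  to distribute them.

  There are finitely many: in an initial partition of length \<open>l\<close> every row but the first either
  costs a unit of deficit itself or forces one in the first row (\<open>row_cost\<close>,
  \<open>closing_row_deficit\<close>), so \<open>l\<close> is at most one more than the deficit and a search with pruning finds them
  all (\<open>initials_complete\<close>).

  The tails are infinite but regular. In terms of Dyck vectors the orbit of \<open>TI \<mu>\<close> runs through
  cycles, each of which appends one zero to the vector, and the side of the enclosing staircase
  grows exactly once per cycle (\<open>tail_growth_TI\<close>). Hence \<open>DP n\<close> contains an initial stretch of the tail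
  whose length is a difference of triangular numbers.

  Along a chain dinv takes each value once, so \<open>Cat n\<close> of a chain is given by the set of
  dinv values occurring inside \<open>DP n\<close>, and the symmetry says that
  \<open>i \<mapsto> (n choose 2) - k - i\<close> exchanges this set with that of the partner chain (\<open>Cat_mirror\<close>). Once \<open>n\<close> is
  so large that \<open>DP n\<close> contains all finite orbits and the start of each tail, the set is an interval and the symmetry
  reduces to one numerical identity about \<open>TI \<mu>\<close>; the other \<open>n\<close>, at most \<open>k + 2\<close>, are checked one by one.

  The distribution of the finite orbits over the chains is a solution of a finite exact-cover
  problem, tabulated for each \<open>k\<close> and verified by rewriting; \<open>table_sound\<close> turns a verified table
  into the required chains.\<close>

section \<open>Deficit and dinv row by row\<close>

text \<open>The number of dinv cells in a row of length \<open>p\<close> placed above \<open>\<gamma>\<close>. A cell of that row in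
  column \<open>j\<close> counts if the \<open>j\<close>-th column height plus \<open>j\<close> is \<open>p\<close> or \<open>p - 1\<close>. As many indices \<open>i\<close>
  have \<open>\<gamma>\<^sub>i + i\<close> equal to \<open>p\<close> or \<open>p - 1\<close>, zero parts included, and the recursion counts these: shifting
  the index by one lowers \<open>p\<close> by one, and the zero parts contribute \<open>min p 2\<close>.\<close>

fun hits :: "nat \<Rightarrow> nat list \<Rightarrow> nat" where
  "hits p [] = min p 2"
| "hits p (x # \<gamma>) = (if x + 1 = p \<or> x + 2 = p then 1 else 0) + hits (p - 1) \<gamma>"

fun row_dinv :: "nat list \<Rightarrow> nat" where
  "row_dinv [] = 0"
| "row_dinv (p # \<gamma>) = hits p \<gamma> + row_dinv \<gamma>"

lemma is_partition_Nil [simp]: "is_partition []"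
  by (simp add: is_partition_def)

lemma is_partition_Cons:
  "is_partition (p # \<gamma>) \<longleftrightarrow> 0 < p \<and> (\<forall>x\<in>set \<gamma>. x \<le> p) \<and> is_partition \<gamma>"
  by (auto simp: is_partition_def)

lemma part_Cons: "part (x # \<gamma>) i = (if i = 1 then x else if i = 0 then 0 else part \<gamma> (i - 1))"
  by (cases i; cases "i - 1") (auto simp: part_def)

definition col :: "nat list \<Rightarrow> nat \<Rightarrow> nat" where
  "col \<gamma> j = length (filter (\<lambda>x. j \<le> x) \<gamma>)"

lemma part_le_hd: "is_partition \<gamma> \<Longrightarrow> x \<in> set \<gamma> \<Longrightarrow> x \<le> part \<gamma> 1"
  by (cases \<gamma>) (auto simp: part_Cons is_partition_Cons)

lemma part_conjugate:
  assumes "is_partition \<gamma>" "1 \<le> j"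
  shows "part (conjugate \<gamma>) j = col \<gamma> j"
proof (cases "j \<le> part \<gamma> 1")
  case True
  have "[Suc 0..<Suc n] ! (j - Suc 0) = j" if "j \<le> n" for n
    using assms(2) that by (subst nth_upt) auto
  then show ?thesis
    using True assms(2) unfolding part_def[of "conjugate \<gamma>"] by (simp add: conjugate_def col_def del: upt_Suc)
next
  case False
  have "\<not> j \<le> x" if "x \<in> set \<gamma>" for x
    using part_le_hd[OF assms(1) that] False by simp
  then have "filter (\<lambda>x. j \<le> x) \<gamma> = []" by (simp add: filter_empty_conv)
  then show ?thesis using False by (simp add: part_def conjugate_def col_def)
qed

text \<open>Columns and rows have the same count because removing the first part \<open>x\<close> shifts the condition
  by one in the columns up to \<open>x\<close> and leaves an interval of empty columns, whose contribution
  changes by one exactly if \<open>x + 1\<close> is \<open>p\<close> or \<open>p - 1\<close>.\<close>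
lemma card_hits:
  assumes "sorted_wrt (\<ge>) \<gamma>"
  shows "card {j\<in>{1..p}. col \<gamma> j + j = p \<or> col \<gamma> j + j + 1 = p} = hits p \<gamma>"
  using assms
proof (induction \<gamma> arbitrary: p)
  case Nil
  have "{j\<in>{1..p}. col [] j + j = p \<or> col [] j + j + 1 = p} = {j\<in>{p-1,p}. 1 \<le> j}"
    by (auto simp: col_def)
  also have "\<dots> = (if p = 0 then {} else if p = 1 then {1} else {p-1,p})" by auto
  also have "card \<dots> = min p 2" by auto
  finally show ?case by simp
next
  case (Cons x \<gamma>)
  let ?A = "{j\<in>{1..p}. col (x # \<gamma>) j + j = p \<or> col (x # \<gamma>) j + j + 1 = p}"
  let ?B = "{j\<in>{1..p-1}. col \<gamma> j + j = p - 1 \<or> col \<gamma> j + j + 1 = p - 1}"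
  have C: "col (x # \<gamma>) j = (if j \<le> x then Suc (col \<gamma> j) else 0)" for j
    using Cons.prems by (auto simp: col_def filter_empty_conv)
  have Z: "col \<gamma> j = 0" if "j > x" for j
    using Cons.prems that by (auto simp: col_def filter_empty_conv)
  have IH: "card ?B = hits (p - 1) \<gamma>" using Cons by auto
  have A: "?A = {j\<in>?B. j \<le> x} \<union> {j\<in>{1..p}. j > x \<and> (j = p \<or> j + 1 = p)}"
    by (auto simp: C)
  have B: "?B = {j\<in>?B. j \<le> x} \<union> {j\<in>{1..p-1}. j > x \<and> (j + 1 = p \<or> j + 2 = p)}"
    (is "_ = ?B'")
  proof (rule set_eqI)
    show "j \<in> ?B \<longleftrightarrow> j \<in> ?B'" for j
      by (cases "j \<le> x") (auto simp: Z)
  qed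
  have cA: "card ?A = card {j\<in>?B. j \<le> x} + card {j\<in>{1..p}. j > x \<and> (j = p \<or> j + 1 = p)}"
    by (subst A, rule card_Un_disjoint) auto
  have cB: "card ?B = card {j\<in>?B. j \<le> x} + card {j\<in>{1..p-1}. j > x \<and> (j + 1 = p \<or> j + 2 = p)}"
    by (subst B, rule card_Un_disjoint) auto
  have "{j\<in>{1..p}. j > x \<and> (j = p \<or> j + 1 = p)} =
      (if p \<le> x then {} else if p = x + 1 then {p} else {p-1,p})" by auto
  then have c1: "card {j\<in>{1..p}. j > x \<and> (j = p \<or> j + 1 = p)} =
      (if p \<le> x then 0 else if p = x + 1 then 1 else 2)" by auto
  have "{j\<in>{1..p-1}. j > x \<and> (j + 1 = p \<or> j + 2 = p)} =
      (if p \<le> x + 1 then {} else if p = x + 2 then {p-1} else {p-2,p-1})" by auto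
  then have c2: "card {j\<in>{1..p-1}. j > x \<and> (j + 1 = p \<or> j + 2 = p)} =
      (if p \<le> x + 1 then 0 else if p = x + 2 then 1 else 2)" by auto
  show ?case using cA cB c1 c2 IH by (simp split: if_splits)
qed

lemma dinv_Cons:
  assumes "is_partition (p # \<gamma>)"
  shows "dinv (p # \<gamma>) = hits p \<gamma> + dinv \<gamma>"
proof -
  have g: "is_partition \<gamma>" using assms by (simp add: is_partition_Cons)
  have srt: "sorted_wrt (\<ge>) \<gamma>" using g by (simp add: is_partition_def)
  let ?good = "\<lambda>\<delta>. {c \<in> diagram \<delta>. arm \<delta> c - leg \<delta> c \<in> {0, 1}}"
  let ?row = "{j\<in>{1..p}. col \<gamma> j + j = p \<or> col \<gamma> j + j + 1 = p}"
  have colC: "col (p # \<gamma>) j = Suc (col \<gamma> j)" if "j \<le> p" for j using that by (simp add: col_def)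
  have le: "part \<gamma> i \<le> p" for i
    using assms by (auto simp: part_def is_partition_Cons)
  have "?good (p # \<gamma>) = Pair 1 ` ?row \<union> (\<lambda>(i, j). (Suc i, j)) ` ?good \<gamma>" (is "?L = ?R")
  proof (rule set_eqI)
    fix c :: "nat \<times> nat"
    obtain i j where c: "c = (i, j)" by force
    consider "i = 0" | "i = 1" | i' where "i = Suc i'" "i' \<ge> 1" by (cases i; cases "i - 1") auto
    then show "c \<in> ?L \<longleftrightarrow> c \<in> ?R"
    proof cases
      case 1 then show ?thesis by (auto simp: c diagram_def)
    next
      case 2
      have "c \<in> ?L \<longleftrightarrow> j \<in> ?row"
        using 2 colC[of j] part_conjugate[OF assms, of j]
        by (auto simp: c diagram_def arm_def leg_def part_Cons)
      moreover have "c \<in> ?R \<longleftrightarrow> j \<in> ?row" using 2 by (auto simp: c diagram_def)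
      ultimately show ?thesis by simp
    next
      case 3
      have "c \<in> ?L \<longleftrightarrow> (i', j) \<in> ?good \<gamma>"
        using 3 colC[of j] part_conjugate[OF assms, of j] part_conjugate[OF g, of j] le[of i']
        by (auto simp: c diagram_def arm_def leg_def part_Cons)
      moreover have "c \<in> ?R \<longleftrightarrow> (i', j) \<in> ?good \<gamma>" using 3 by (auto simp: c)
      ultimately show ?thesis by simp
    qed
  qed
  then have "card (?good (p # \<gamma>)) = card ?R" by (rule arg_cong)
  also have "\<dots> = card (Pair (1::nat) ` ?row) + card ((\<lambda>(i, j). (Suc i, j)) ` ?good \<gamma>)"
  proof (rule card_Un_disjoint)
    have "?good \<gamma> \<subseteq> {1..length \<gamma>} \<times> {1..p}"
      using le by (auto simp: diagram_def) (meson order_trans)+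
    then have "finite (?good \<gamma>)" by (rule finite_subset) auto
    then show "finite ((\<lambda>(i, j). (Suc i, j)) ` ?good \<gamma>)" by (rule finite_imageI)
  qed (auto simp: diagram_def)
  also have "card (Pair (1::nat) ` ?row) = card ?row" by (rule card_image) (auto simp: inj_on_def)
  also have "card ((\<lambda>(i, j). (Suc i, j)) ` ?good \<gamma>) = card (?good \<gamma>)"
    by (rule card_image) (auto simp: inj_on_def)
  finally show ?thesis unfolding dinv_def card_hits[OF srt] .
qed

lemma dinv_Nil: "dinv [] = 0"
proof -
  have "diagram [] = {}" by (auto simp: diagram_def)
  then show ?thesis by (simp add: dinv_def)
qed

lemma dinv_eq_row_dinv: "is_partition \<gamma> \<Longrightarrow> dinv \<gamma> = row_dinv \<gamma>"
  by (induction \<gamma>) (auto simp: dinv_Nil dinv_Cons is_partition_Cons)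

lemma hits_le: "hits p \<gamma> \<le> p"
proof (induction \<gamma> arbitrary: p)
  case (Cons x \<gamma>)
  show ?case using Cons[of "p - 1"] by auto
qed simp

section \<open>The map nu and its orbits\<close>

lemma drop_zeros_Cons: "drop_zeros (x # \<gamma>) = (if x = 0 then drop_zeros \<gamma> else x # drop_zeros \<gamma>)"
  by (simp add: drop_zeros_def)

lemma drop_zeros_append: "drop_zeros (xs @ ys) = drop_zeros xs @ drop_zeros ys"
  by (simp add: drop_zeros_def)

lemma drop_zeros_Nil [simp]: "drop_zeros [] = []"
  by (simp add: drop_zeros_def)

lemma nu_eq: "nu \<gamma> = (if part \<gamma> 1 \<le> length \<gamma> + 2
    then Some (Suc (length \<gamma>) # drop_zeros (map (\<lambda>x. x - 1) \<gamma>)) else None)"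
  by (simp add: nu_def drop_zeros_Cons)

lemma set_drop_zeros: "set (drop_zeros \<gamma>) = set \<gamma> - {0}"
  by (auto simp: drop_zeros_def)

lemma is_partition_drop_zeros: "sorted_wrt (\<ge>) \<gamma> \<Longrightarrow> is_partition (drop_zeros \<gamma>)"
  by (auto simp: drop_zeros_def is_partition_def sorted_wrt_filter)

lemma is_partition_nu:
  assumes "is_partition \<gamma>" "nu \<gamma> = Some \<delta>"
  shows "is_partition \<delta>"
proof -
  have s: "sorted_wrt (\<ge>) (map (\<lambda>x. x - 1) \<gamma>)"
    using assms(1) by (auto simp: is_partition_def sorted_wrt_map intro: sorted_wrt_mono_rel[rotated])
  have "x - 1 \<le> Suc (length \<gamma>)" if "x \<in> set \<gamma>" for x
    using part_le_hd[OF assms(1) that] assms(2) by (auto simp: nu_eq split: if_splits)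
  then show ?thesis
    using assms(2) is_partition_drop_zeros[OF s]
    by (auto simp: nu_eq is_partition_Cons set_drop_zeros split: if_splits)
qed

lemma hits_zeros: "set \<gamma> \<subseteq> {0} \<Longrightarrow> hits p \<gamma> = min p 2"
proof (induction \<gamma> arbitrary: p)
  case (Cons x \<gamma>)
  then show ?case by auto
qed simp

lemma drop_zeros_zeros: "set \<gamma> \<subseteq> {0} \<Longrightarrow> drop_zeros \<gamma> = []"
  by (induction \<gamma>) (auto simp: drop_zeros_Cons)

lemma hits_drop_zeros: "sorted_wrt (\<ge>) \<gamma> \<Longrightarrow> hits p (drop_zeros \<gamma>) = hits p \<gamma>"
proof (induction \<gamma> arbitrary: p)
  case (Cons x \<gamma>)
  show ?case
  proof (cases "x = 0")
    case True
    then have "set (x # \<gamma>) \<subseteq> {0}" using Cons.prems by auto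
    then show ?thesis using hits_zeros[of "x # \<gamma>" p] drop_zeros_zeros[of "x # \<gamma>"] by simp
  next
    case False
    then show ?thesis using Cons by (auto simp: drop_zeros_Cons)
  qed
qed simp

lemma row_dinv_drop_zeros: "sorted_wrt (\<ge>) \<gamma> \<Longrightarrow> row_dinv (drop_zeros \<gamma>) = row_dinv \<gamma>"
proof (induction \<gamma>)
  case (Cons x \<gamma>)
  show ?case
  proof (cases "x = 0")
    case True
    then show ?thesis using Cons hits_le[of 0 \<gamma>] by (auto simp: drop_zeros_Cons)
  next
    case False
    then show ?thesis using Cons hits_drop_zeros[of \<gamma> x] by (auto simp: drop_zeros_Cons)
  qed
qed simp

lemma hits_map_pred:
  assumes "\<forall>x\<in>set \<gamma>. x > 0"
  shows "hits (Suc p) \<gamma> = hits p (map (\<lambda>x. x - 1) \<gamma>) + (if p = length \<gamma> \<or> p = Suc (length \<gamma>) then 1 else 0)"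
  using assms
proof (induction \<gamma> arbitrary: p)
  case Nil
  then show ?case by auto
next
  case (Cons x \<gamma>)
  show ?case
  proof (cases p)
    case 0
    have "hits 0 \<gamma> = 0" "hits 0 (map (\<lambda>x. x - 1) \<gamma>) = 0"
      using hits_le[of 0] by auto
    then show ?thesis using 0 Cons.prems by auto
  next
    case (Suc q)
    have "x - 1 + 1 = Suc q \<or> x - 1 + 2 = Suc q \<longleftrightarrow> x + 1 = Suc (Suc q) \<or> x + 2 = Suc (Suc q)"
      using Cons.prems by auto
    then show ?thesis using Cons Suc by simp
  qed
qed

text \<open>The dinv cells in the first column: the first cell of a row of length \<open>x\<close> has arm \<open>x - 1\<close>, and
  its leg is the number \<open>length \<gamma>\<close> of rows below.\<close>
fun first_col :: "nat list \<Rightarrow> nat" where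
  "first_col [] = 0"
| "first_col (x # \<gamma>) = (if x = length \<gamma> + 1 \<or> x = length \<gamma> + 2 then 1 else 0) + first_col \<gamma>"

lemma row_dinv_map_pred:
  assumes "\<forall>x\<in>set \<gamma>. x > 0"
  shows "row_dinv \<gamma> = row_dinv (map (\<lambda>x. x - 1) \<gamma>) + first_col \<gamma>"
  using assms
proof (induction \<gamma>)
  case (Cons x \<gamma>)
  then show ?case using hits_map_pred[of \<gamma> "x - 1"] by auto
qed simp

lemma hits_first_col: "hits (Suc (Suc (length \<gamma>))) \<gamma> = Suc (Suc (first_col \<gamma>))"
  by (induction \<gamma>) auto

text \<open>\<open>nu\<close> trades the first column for a new first row of length \<open>length \<gamma> + 1\<close>. By the row count the
  dinv cells of both are indexed by the parts with \<open>\<gamma>\<^sub>i + i\<close> in \<open>{length \<gamma> + 1, length \<gamma> + 2}\<close>; zero parts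
  give the new row one extra cell.\<close>
lemma dinv_nu:
  assumes "is_partition \<gamma>" "nu \<gamma> = Some \<delta>"
  shows "dinv \<delta> = Suc (dinv \<gamma>)"
proof -
  let ?g = "map (\<lambda>x. x - 1) \<gamma>"
  have s: "sorted_wrt (\<ge>) ?g"
    using assms(1) by (auto simp: is_partition_def sorted_wrt_map intro: sorted_wrt_mono_rel[rotated])
  have pos: "\<forall>x\<in>set \<gamma>. x > 0" using assms(1) by (simp add: is_partition_def)
  have \<delta>: "\<delta> = Suc (length \<gamma>) # drop_zeros ?g" using assms(2) by (auto simp: nu_eq split: if_splits)
  have "row_dinv \<delta> = hits (Suc (length \<gamma>)) ?g + row_dinv ?g"
    using s by (simp add: \<delta> hits_drop_zeros row_dinv_drop_zeros)
  also have "Suc (hits (Suc (length \<gamma>)) ?g) = hits (Suc (Suc (length \<gamma>))) \<gamma>"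
    using hits_map_pred[OF pos, of "Suc (length \<gamma>)"] by simp
  then have "hits (Suc (length \<gamma>)) ?g = Suc (first_col \<gamma>)" by (simp add: hits_first_col)
  finally show ?thesis
    using row_dinv_map_pred[OF pos] dinv_eq_row_dinv assms(1) is_partition_nu[OF assms] by simp
qed

lemma psize_drop_zeros: "psize (drop_zeros \<gamma>) = psize \<gamma>"
  by (induction \<gamma>) (auto simp: drop_zeros_Cons)

lemma psize_map_pred: "\<forall>x\<in>set \<gamma>. x > 0 \<Longrightarrow> psize (map (\<lambda>x. x - 1) \<gamma>) + length \<gamma> = psize \<gamma>"
  by (induction \<gamma>) auto

lemma psize_nu:
  assumes "is_partition \<gamma>" "nu \<gamma> = Some \<delta>"
  shows "psize \<delta> = Suc (psize \<gamma>)"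
  using assms psize_map_pred[of \<gamma>]
  by (auto simp: nu_eq psize_drop_zeros is_partition_def split: if_splits)

lemma defc_nu: "is_partition \<gamma> \<Longrightarrow> nu \<gamma> = Some \<delta> \<Longrightarrow> defc \<delta> = defc \<gamma>"
  by (simp add: defc_def dinv_nu psize_nu)

text \<open>The partitions outside the image of \<open>nu\<close>.\<close>
definition initial :: "nat list \<Rightarrow> bool" where
  "initial \<gamma> \<longleftrightarrow> (case \<gamma> of [] \<Rightarrow> True | p # \<delta> \<Rightarrow> p \<le> length \<delta>)"

fun nu_inv :: "nat list \<Rightarrow> nat list" where
  "nu_inv [] = []"
| "nu_inv (p # \<gamma>) = map Suc \<gamma> @ replicate (p - 1 - length \<gamma>) 1"

lemma nu_inv_drop_zeros:
  assumes "is_partition \<gamma>"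
  shows "map Suc (drop_zeros (map (\<lambda>x. x - 1) \<gamma>)) @
    replicate (length \<gamma> - length (drop_zeros (map (\<lambda>x. x - 1) \<gamma>))) 1 = \<gamma>"
  using assms
proof (induction \<gamma>)
  case (Cons x \<gamma>)
  have IH: "map Suc (drop_zeros (map (\<lambda>x. x - 1) \<gamma>)) @
    replicate (length \<gamma> - length (drop_zeros (map (\<lambda>x. x - 1) \<gamma>))) 1 = \<gamma>"
    using Cons by (simp add: is_partition_Cons)
  show ?case
  proof (cases "x = 1")
    case True
    then have all1: "y = 1" if "y \<in> set \<gamma>" for y
      using Cons.prems that by (fastforce simp: is_partition_def)
    then have "set (map (\<lambda>x. x - 1) (x # \<gamma>)) \<subseteq> {0}" using True by auto
    then have "drop_zeros (map (\<lambda>x. x - 1) (x # \<gamma>)) = []" by (rule drop_zeros_zeros)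
    moreover have "\<gamma> = replicate (length \<gamma>) 1" using all1 by (auto intro: replicate_eqI)
    ultimately show ?thesis using True by (simp only:) simp
  next
    case False
    then have "x > 1" using Cons.prems by (auto simp: is_partition_def)
    then show ?thesis using IH by (simp add: drop_zeros_Cons)
  qed
qed simp

lemma nu_inv_nu:
  assumes "is_partition \<gamma>" "nu \<gamma> = Some \<delta>"
  shows "nu_inv \<delta> = \<gamma>"
  using assms nu_inv_drop_zeros[OF assms(1)] by (auto simp: nu_eq split: if_splits)

lemma not_initial_nu: "nu \<gamma> = Some \<delta> \<Longrightarrow> \<not> initial \<delta>"
proof -
  assume "nu \<gamma> = Some \<delta>"
  then have \<delta>: "\<delta> = Suc (length \<gamma>) # drop_zeros (map (\<lambda>x. x - 1) \<gamma>)"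
    by (auto simp: nu_eq split: if_splits)
  have "length (drop_zeros (map (\<lambda>x. x - 1) \<gamma>)) \<le> length \<gamma>"
    unfolding drop_zeros_def by (metis length_filter_le length_map)
  then show ?thesis by (simp add: \<delta> initial_def)
qed

lemma ex_nu_inv:
  assumes "is_partition \<gamma>" "\<not> initial \<gamma>"
  shows "is_partition (nu_inv \<gamma>)" "nu (nu_inv \<gamma>) = Some \<gamma>"
proof -
  obtain p g where g: "\<gamma> = p # g" and l: "length g < p"
    using assms(2) by (auto simp: initial_def split: list.splits)
  have 1: "is_partition g" "\<forall>x\<in>set g. x \<le> p" "0 < p" using assms(1) by (auto simp: g is_partition_Cons)
  have "sorted_wrt (\<ge>) (replicate n (1::nat))" for n
    by (induction n) auto
  then show "is_partition (nu_inv \<gamma>)"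
    using 1 by (auto simp: g is_partition_def sorted_wrt_append sorted_wrt_map)
  have "drop_zeros g = g" using 1 by (auto simp: drop_zeros_def is_partition_def filter_id_conv)
  moreover have "part (map Suc g @ replicate (p - 1 - length g) 1) 1 \<le> p + 1"
    using 1 by (cases g; cases "p - 1 - length g") (auto simp: part_def)
  ultimately show "nu (nu_inv \<gamma>) = Some \<gamma>"
    using l by (auto simp: g nu_eq drop_zeros_append comp_def drop_zeros_zeros set_replicate_conv_if)
qed

definition nu_iter :: "nat list \<Rightarrow> nat \<Rightarrow> nat list option" where
  "nu_iter \<gamma> m = ((\<lambda>x. Option.bind x nu) ^^ m) (Some \<gamma>)"

definition orbit :: "nat list \<Rightarrow> nat list set" where
  "orbit \<gamma> = {\<delta>. \<exists>m. nu_iter \<gamma> m = Some \<delta>}"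

lemma tail_eq_orbit: "tail \<mu> = orbit (TI \<mu>)"
  by (simp add: tail_def orbit_def nu_iter_def)

lemma nu_iter_0 [simp]: "nu_iter \<gamma> 0 = Some \<gamma>"
  by (simp add: nu_iter_def)

lemma nu_iter_Suc: "nu_iter \<gamma> (Suc m) = Option.bind (nu_iter \<gamma> m) nu"
  by (simp add: nu_iter_def)

lemma nu_iter_add: "nu_iter \<gamma> m = Some \<delta> \<Longrightarrow> nu_iter \<gamma> (m + n) = nu_iter \<delta> n"
  by (induction n) (auto simp: nu_iter_Suc)

lemma nu_iter_props:
  assumes "is_partition \<gamma>" "nu_iter \<gamma> m = Some \<delta>"
  shows "is_partition \<delta> \<and> dinv \<delta> = dinv \<gamma> + m \<and> defc \<delta> = defc \<gamma>"
  using assms(2)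
proof (induction m arbitrary: \<delta>)
  case (Suc m)
  then obtain \<eta> where "nu_iter \<gamma> m = Some \<eta>" "nu \<eta> = Some \<delta>"
    by (auto simp: nu_iter_Suc Option.bind_eq_Some_conv)
  then show ?case using Suc.IH[of \<eta>] is_partition_nu[of \<eta> \<delta>] dinv_nu[of \<eta> \<delta>] defc_nu[of \<eta> \<delta>] by simp
qed (use assms in auto)

lemma orbit_refl: "\<gamma> \<in> orbit \<gamma>"
  unfolding orbit_def using nu_iter_0 by blast

lemma orbit_closed: "\<delta> \<in> orbit \<gamma> \<Longrightarrow> nu \<delta> = Some \<epsilon> \<Longrightarrow> \<epsilon> \<in> orbit \<gamma>"
proof -
  assume "\<delta> \<in> orbit \<gamma>" "nu \<delta> = Some \<epsilon>"
  then obtain m where "nu_iter \<gamma> m = Some \<delta>" by (auto simp: orbit_def)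
  then have "nu_iter \<gamma> (Suc m) = Some \<epsilon>" using \<open>nu \<delta> = Some \<epsilon>\<close> by (simp add: nu_iter_Suc)
  then show ?thesis unfolding orbit_def by blast
qed

lemma orbit_partition: "is_partition \<gamma> \<Longrightarrow> \<delta> \<in> orbit \<gamma> \<Longrightarrow> is_partition \<delta>"
  and orbit_defc: "is_partition \<gamma> \<Longrightarrow> \<delta> \<in> orbit \<gamma> \<Longrightarrow> defc \<delta> = defc \<gamma>"
  by (auto simp: orbit_def dest: nu_iter_props)

lemma ex_initial:
  assumes "is_partition \<gamma>"
  shows "\<exists>\<gamma>0. is_partition \<gamma>0 \<and> initial \<gamma>0 \<and> \<gamma> \<in> orbit \<gamma>0"
  using assms
proof (induction "dinv \<gamma>" arbitrary: \<gamma> rule: less_induct)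
  case less
  show ?case
  proof (cases "initial \<gamma>")
    case True
    then show ?thesis using less.prems orbit_refl by blast
  next
    case False
    note p = ex_nu_inv[OF less.prems False]
    have "dinv (nu_inv \<gamma>) < dinv \<gamma>" using dinv_nu[OF p] by simp
    then obtain \<gamma>0 where "is_partition \<gamma>0" "initial \<gamma>0" "nu_inv \<gamma> \<in> orbit \<gamma>0"
      using less.hyps p(1) by blast
    then show ?thesis using orbit_closed p(2) by blast
  qed
qed

text \<open>Running two orbits backwards from a common element, injectivity of \<open>nu\<close> keeps them together
  until one, and hence the other, reaches its initial partition.\<close>
lemma nu_iter_initial_inj:
  assumes "is_partition \<gamma>" "is_partition \<gamma>'" "initial \<gamma>" "initial \<gamma>'"
    "nu_iter \<gamma> m = Some \<delta>" "nu_iter \<gamma>' m' = Some \<delta>"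
  shows "\<gamma> = \<gamma>'"
  using assms(5,6)
proof (induction m arbitrary: m' \<delta>)
  case 0
  then show ?case using assms(3)
    by (cases m') (auto simp: nu_iter_Suc Option.bind_eq_Some_conv not_initial_nu)
next
  case (Suc m)
  then obtain \<eta> where \<eta>: "nu_iter \<gamma> m = Some \<eta>" "nu \<eta> = Some \<delta>"
    by (auto simp: nu_iter_Suc Option.bind_eq_Some_conv)
  with Suc.prems(2) assms(4) obtain n where "m' = Suc n" by (cases m') (auto simp: not_initial_nu)
  with Suc.prems(2) obtain \<eta>' where \<eta>': "nu_iter \<gamma>' n = Some \<eta>'" "nu \<eta>' = Some \<delta>"
    by (auto simp: nu_iter_Suc Option.bind_eq_Some_conv)
  have "\<eta> = \<eta>'"
    using nu_inv_nu[of \<eta> \<delta>] nu_inv_nu[of \<eta>' \<delta>] \<eta> \<eta>' nu_iter_props assms(1,2) by metis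
  then show ?case using Suc.IH \<eta> \<eta>' by blast
qed

lemma orbit_disjoint:
  assumes "is_partition \<gamma>" "is_partition \<gamma>'" "initial \<gamma>" "initial \<gamma>'" "\<gamma> \<noteq> \<gamma>'"
  shows "orbit \<gamma> \<inter> orbit \<gamma>' = {}"
  using nu_iter_initial_inj[OF assms(1-4)] assms(5) by (auto simp: orbit_def)

section \<open>Growth of the tails\<close>

fun tri :: "nat \<Rightarrow> nat" where
  "tri 0 = 0"
| "tri (Suc n) = n + tri n"

lemma tri_eq_choose: "tri n = n choose 2"
  by (induction n) (auto simp: numeral_2_eq_2)

lemma tri_mono: "m \<le> n \<Longrightarrow> tri m \<le> tri n"
  by (rule lift_Suc_mono_le) auto

text \<open>A recursive form of \<open>min_Delta\<close>. The base value 1, correct for the empty partition, does no harm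
  below a last part \<open>x > 0\<close>, which already contributes \<open>x + 1 \<ge> 2\<close>.\<close>
fun size_Delta :: "nat list \<Rightarrow> nat" where
  "size_Delta [] = 1"
| "size_Delta (x # \<gamma>) = max (Suc x) (Suc (size_Delta \<gamma>))"

lemma size_Delta_le_iff:
  "\<forall>x\<in>set \<gamma>. x > 0 \<Longrightarrow>
    size_Delta \<gamma> \<le> n \<longleftrightarrow> 0 < n \<and> (\<forall>i\<in>{1..length \<gamma>}. part \<gamma> i + i \<le> n)"
proof (induction \<gamma> arbitrary: n)
  case Nil
  then show ?case by auto
next
  case (Cons x \<gamma>)
  have ball: "(\<forall>i\<in>{1..length (x # \<gamma>)}. part (x # \<gamma>) i + i \<le> n) \<longleftrightarrow>
      x + 1 \<le> n \<and> (\<forall>i\<in>{1..length \<gamma>}. part \<gamma> i + i \<le> n - 1)" (is "?L \<longleftrightarrow> ?R")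
  proof
    assume L: ?L
    have "part \<gamma> i + i \<le> n - 1" if "i \<in> {1..length \<gamma>}" for i
      using L[rule_format, of "Suc i"] that by (auto simp: part_Cons)
    then show ?R using L[rule_format, of 1] by (auto simp: part_Cons)
  next
    assume R: ?R
    show ?L
    proof
      fix i assume i: "i \<in> {1..length (x # \<gamma>)}"
      show "part (x # \<gamma>) i + i \<le> n"
      proof (cases "i = 1")
        case False
        then have "i - 1 \<in> {1..length \<gamma>}" using i by auto
        then have "part \<gamma> (i - 1) + (i - 1) \<le> n - 1" using R by blast
        then show ?thesis using False R i by (simp add: part_Cons) linarith
      qed (use R in \<open>auto simp: part_Cons\<close>)
    qed
  qed
  have x: "x > 0" using Cons.prems by simp
  have "size_Delta (x # \<gamma>) \<le> n \<longleftrightarrow> Suc x \<le> n \<and> size_Delta \<gamma> \<le> n - 1"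
    by (cases n) auto
  also have "\<dots> \<longleftrightarrow> 0 < n \<and> Suc x \<le> n \<and> (\<forall>i\<in>{1..length \<gamma>}. part \<gamma> i + i \<le> n - 1)"
    using Cons.IH[of "n - 1"] Cons.prems x by (simp, linarith)
  finally show ?case using ball by simp
qed

lemma min_Delta_eq_size_Delta: "is_partition \<gamma> \<Longrightarrow> min_Delta \<gamma> = size_Delta \<gamma>"
  unfolding min_Delta_def
proof (rule Least_equality)
  assume "is_partition \<gamma>"
  then have "\<forall>x\<in>set \<gamma>. x > 0" by (simp add: is_partition_def)
  note iff = size_Delta_le_iff[OF this]
  show "0 < size_Delta \<gamma> \<and> (\<forall>i\<in>{1..length \<gamma>}. part \<gamma> i + i \<le> size_Delta \<gamma>)"
    using iff[of "size_Delta \<gamma>"] by blast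
  show "size_Delta \<gamma> \<le> n" if "0 < n \<and> (\<forall>i\<in>{1..length \<gamma>}. part \<gamma> i + i \<le> n)" for n
    using iff[of n] that by blast
qed

text \<open>The partition of a Dyck vector, given in reverse, whose entries are preceded by \<open>c\<close> further
  entries that contribute no parts; a vector entry \<open>x\<close> measures how far its row falls short of
  the staircase.\<close>
fun stair :: "nat \<Rightarrow> nat list \<Rightarrow> nat list" where
  "stair c [] = []"
| "stair c (x # r) = (length r + c - x) # stair c r"

lemma stair_append: "stair c (r @ r') = stair (length r' + c) r @ stair c r'"
  by (induction r) (auto simp: add.assoc)

lemma stair_map_Suc: "stair (Suc c) (map Suc r) = stair c r"
  by (induction r) auto

lemma map_pred_stair: "map (\<lambda>x. x - 1) (stair (Suc c) r) = stair c r"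
  by (induction r) auto

lemma stair_pos: "\<forall>x\<in>set r. x < c \<Longrightarrow> \<forall>y\<in>set (stair c r). 0 < y"
  by (induction r) auto

lemma length_stair [simp]: "length (stair c r) = length r"
  by (induction r) auto

lemma size_Delta_stair_le: "0 < c \<Longrightarrow> size_Delta (stair c r) \<le> length r + c"
  by (induction r) auto

lemma size_Delta_stair: "0 < c \<Longrightarrow> 0 \<in> set r \<Longrightarrow> size_Delta (stair c r) = length r + c"
proof (induction r)
  case (Cons x r)
  then show ?case using size_Delta_stair_le[of c r] by (cases "x = 0") auto
qed simp

lemma drop_zeros_id: "\<forall>x\<in>set \<gamma>. 0 < x \<Longrightarrow> drop_zeros \<gamma> = \<gamma>"
  by (simp add: drop_zeros_def filter_id_conv)

lemma stair_pos_hd: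
  assumes "\<forall>x\<in>set v. x \<le> c" "v \<noteq> [] \<Longrightarrow> hd v < c"
  shows "\<forall>y\<in>set (stair c (rev v)). 0 < y"
proof (cases v)
  case (Cons h t)
  have "\<forall>y\<in>set (stair (Suc c) (rev t)). 0 < y"
    by (rule stair_pos) (use assms(1) Cons in \<open>auto simp: less_Suc_eq_le\<close>)
  then show ?thesis using assms(2) by (auto simp: Cons stair_append)
qed simp

text \<open>The condition \<open>c \<le> 2\<close> is the one under which \<open>nu\<close> is defined: the first part is at most
  \<open>length v + c\<close>.\<close>
lemma nu_stair:
  assumes "\<forall>x\<in>set v. x \<le> Suc c" "v \<noteq> [] \<Longrightarrow> hd v < Suc c" "c \<le> 2"
  shows "nu (stair (Suc c) (rev v)) = Some (Suc (length v) # drop_zeros (stair c (rev v)))"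
proof -
  have "part (stair (Suc c) r) 1 \<le> length r + 2" for r
    using assms(3) by (cases r) (auto simp: part_Cons part_def)
  from this[of "rev v"] show ?thesis
    using map_pred_stair[of c "rev v"] by (simp add: nu_eq)
qed

text \<open>The tails pass through two kinds of vectors: \<open>(0, 0, W)\<close>, and \<open>(0, 1, W + 1, U)\<close> in which \<open>W + 1\<close> raises all
  entries by one. Here \<open>W\<close> and \<open>U\<close> consist of zeros and ones. Starting from \<open>(0, 0, W)\<close>, the map \<open>nu\<close> leads to
  \<open>(0, 1, W + 1, 0)\<close>, then moves the entries of \<open>W\<close> one at a time to the end of \<open>U\<close>, and finally
  returns to the first form with \<open>W\<close> lengthened by a zero.\<close>
definition cycle_start :: "nat list \<Rightarrow> nat list" where
  "cycle_start W = stair 1 (rev (0 # W))"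

definition cycle_mid :: "nat list \<Rightarrow> nat list \<Rightarrow> nat list" where
  "cycle_mid W U = drop_zeros (stair 2 (rev (map Suc W @ U)))"

lemma nu_cycle_start:
  assumes "set W \<subseteq> {0, 1}"
  shows "nu (cycle_start W) = Some (cycle_mid W [0])"
proof -
  have "nu (cycle_start W) = Some (Suc (length (0 # W)) # drop_zeros (stair 0 (rev (0 # W))))"
    unfolding cycle_start_def One_nat_def by (rule nu_stair) (use assms in auto)
  moreover have "stair 2 (map Suc r) = stair 1 r" for r
    using stair_map_Suc[of 1 r] by (simp add: numeral_2_eq_2)
  ultimately show ?thesis
    by (simp add: cycle_mid_def stair_append drop_zeros_append drop_zeros_Cons rev_map)
qed

lemma cycle_mid_Cons:
  assumes "set W \<subseteq> {0, 1}" "set U \<subseteq> {0, 1}" "x \<in> {0, 1}"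
  shows "cycle_mid (x # W) U =
    (if x = 0 then stair 2 (rev (1 # map Suc W @ U)) else stair 3 (rev (map Suc W @ U)))"
proof (cases "x = 0")
  case True
  have "\<forall>y\<in>set (stair 2 (rev (1 # map Suc W @ U))). 0 < y"
    by (rule stair_pos_hd) (use assms in auto)
  then show ?thesis using True by (simp add: cycle_mid_def drop_zeros_id)
next
  case False
  have "\<forall>y\<in>set (stair 3 (rev (map Suc W @ U))). 0 < y"
    by (rule stair_pos) (use assms in auto)
  then show ?thesis using False assms
    by (auto simp: cycle_mid_def stair_append drop_zeros_append drop_zeros_Cons drop_zeros_id
        add.commute numeral_eq_Suc)
qed

lemma nu_cycle_mid_Cons:
  assumes "set W \<subseteq> {0, 1}" "set U \<subseteq> {0, 1}" "x \<in> {0, 1}"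
  shows "nu (cycle_mid (x # W) U) = Some (cycle_mid W (U @ [x]))"
proof (cases "x = 0")
  case True
  let ?v = "1 # map Suc W @ U"
  have "cycle_mid (x # W) U = stair (Suc 1) (rev ?v)" using cycle_mid_Cons[OF assms] True by (simp add: numeral_2_eq_2)
  also have "nu \<dots> = Some (Suc (length ?v) # drop_zeros (stair 1 (rev ?v)))"
    by (rule nu_stair) (use assms in auto)
  also have "Suc (length ?v) # drop_zeros (stair 1 (rev ?v)) = cycle_mid W (U @ [x])"
    using True by (simp add: cycle_mid_def stair_append drop_zeros_append drop_zeros_Cons numeral_2_eq_2)
  finally show ?thesis .
next
  case False
  let ?v = "map Suc W @ U"
  have "cycle_mid (x # W) U = stair (Suc 2) (rev ?v)" using cycle_mid_Cons[OF assms] False by (simp add: numeral_eq_Suc)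
  also have "nu \<dots> = Some (Suc (length ?v) # drop_zeros (stair 2 (rev ?v)))"
  proof (rule nu_stair)
    have lt: "y < Suc 2" if "y \<in> set ?v" for y using that assms by auto
    show "\<forall>y\<in>set ?v. y \<le> Suc 2" using lt less_imp_le by blast
    show "hd ?v < Suc 2" if "?v \<noteq> []" using lt hd_in_set[OF that] by blast
  qed simp
  also have "Suc (length ?v) # drop_zeros (stair 2 (rev ?v)) = cycle_mid W (U @ [x])"
    using False assms(3) by (simp add: cycle_mid_def drop_zeros_Cons numeral_2_eq_2)
  finally show ?thesis .
qed

lemma cycle_mid_Nil:
  assumes "set U \<subseteq> {0, 1}"
  shows "cycle_mid [] U = stair 2 (rev U)"
  unfolding cycle_mid_def list.map append_Nil
  by (rule drop_zeros_id, rule stair_pos) (use assms in auto)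

lemma nu_cycle_mid_Nil:
  assumes "set U \<subseteq> {0, 1}"
  shows "nu (cycle_mid [] (0 # U)) = Some (cycle_start (U @ [0]))"
proof -
  have *: "nu (stair (Suc 1) (rev (0 # U))) =
      Some (Suc (length (0 # U)) # drop_zeros (stair 1 (rev (0 # U))))"
    by (rule nu_stair) (use assms in auto)
  have "\<forall>y\<in>set (stair 1 (rev (0 # U))). 0 < y"
    by (rule stair_pos_hd) (use assms in auto)
  then have "drop_zeros (stair 1 (rev (0 # U))) = stair 1 (rev (0 # U))" by (rule drop_zeros_id)
  then show ?thesis using * cycle_mid_Nil[of "0 # U"] assms by (simp add: cycle_start_def numeral_eq_Suc)
qed

lemma size_Delta_cycle_start: "size_Delta (cycle_start W) = length W + 2"
  unfolding cycle_start_def by (subst size_Delta_stair) auto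

lemma size_Delta_cycle_mid:
  assumes "set W \<subseteq> {0, 1}" "set U \<subseteq> {0, 1}" "0 \<in> set U"
  shows "size_Delta (cycle_mid W U) = length W + length U + 2"
proof (cases W)
  case Nil
  then show ?thesis using assms by (simp add: cycle_mid_Nil size_Delta_stair)
next
  case (Cons x W')
  then show ?thesis using assms by (simp add: cycle_mid_Cons size_Delta_stair del: rev.simps rev_append)
qed

lemma nu_iter_within_cycle:
  assumes "set W \<subseteq> {0, 1}" "j \<le> length W"
  shows "nu_iter (cycle_start W) (Suc j) = Some (cycle_mid (drop j W) (0 # take j W))"
  using assms(2)
proof (induction j)
  case 0
  then show ?case using nu_cycle_start[OF assms(1)] by (simp add: nu_iter_Suc)
next
  case (Suc j)
  have d: "drop j W = W ! j # drop (Suc j) W" "take (Suc j) W = take j W @ [W ! j]"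
    using Suc.prems by (auto simp: Cons_nth_drop_Suc take_Suc_conv_app_nth)
  have "W ! j \<in> {0, 1}" using Suc.prems assms(1) nth_mem[of j W] by (meson Suc_le_lessD subsetD)
  moreover have "set (drop (Suc j) W) \<subseteq> {0, 1}" "set (0 # take j W) \<subseteq> {0, 1}"
    using assms(1) set_drop_subset[of "Suc j" W] set_take_subset[of j W] by auto
  ultimately have "nu (cycle_mid (drop j W) (0 # take j W)) = Some (cycle_mid (drop (Suc j) W) (0 # take (Suc j) W))"
    using nu_cycle_mid_Cons[of "drop (Suc j) W" "0 # take j W" "W ! j"] by (simp add: d)
  then show ?case using Suc by (simp add: nu_iter_Suc)
qed

lemma nu_iter_whole_cycle:
  assumes "set W \<subseteq> {0, 1}"
  shows "nu_iter (cycle_start W) (length W + 2) = Some (cycle_start (W @ [0]))"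
  using nu_iter_within_cycle[OF assms, of "length W"] nu_cycle_mid_Nil[OF assms] by (simp add: nu_iter_Suc)

text \<open>After \<open>m\<close> steps the orbit is inside the staircase of side \<open>n\<close> iff \<open>n\<close> is at least the side \<open>N\<close> of the
  starting point and \<open>m\<close> does not exceed the difference of the triangular numbers for \<open>n\<close> and \<open>N\<close>, since the cycle that starts at side \<open>N\<close> has \<open>N\<close> steps and raises the side by one.\<close>
definition tail_growth :: "nat \<Rightarrow> nat list \<Rightarrow> bool" where
  "tail_growth N \<gamma> \<longleftrightarrow> (\<forall>m. \<exists>\<delta>. nu_iter \<gamma> m = Some \<delta> \<and>
     (\<forall>n. size_Delta \<delta> \<le> n \<longleftrightarrow> N \<le> n \<and> m + tri N \<le> tri n))"

lemma tail_growth_cycle_start: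
  assumes "set W \<subseteq> {0, 1}"
  shows "tail_growth (length W + 2) (cycle_start W)"
  unfolding tail_growth_def
proof
  fix m
  show "\<exists>\<delta>. nu_iter (cycle_start W) m = Some \<delta> \<and>
     (\<forall>n. size_Delta \<delta> \<le> n \<longleftrightarrow> length W + 2 \<le> n \<and> m + tri (length W + 2) \<le> tri n)"
    using assms
  proof (induction m arbitrary: W rule: less_induct)
    case (less m)
    consider "m = 0" | j where "m = Suc j" "j \<le> length W" | m' where "m = length W + 2 + m'"
      using le_Suc_ex[of "length W + 2" m] by (cases m) fastforce+
    then show ?case
    proof cases
      case 1
      then show ?thesis using tri_mono[of "length W + 2"] by (auto simp: size_Delta_cycle_start simp del: tri.simps)
    next
      case 2
      have "set (drop j W) \<subseteq> {0, 1}" "set (0 # take j W) \<subseteq> {0, 1}"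
        using less.prems set_drop_subset[of j W] set_take_subset[of j W] by auto
      then have "size_Delta (cycle_mid (drop j W) (0 # take j W)) = length W + 3"
        using size_Delta_cycle_mid[of "drop j W" "0 # take j W"] 2 by simp
      moreover have "length W + 3 \<le> n \<longleftrightarrow> length W + 2 \<le> n \<and> m + tri (length W + 2) \<le> tri n" for n
        using 2 tri_mono[of "length W + 3" n] by (cases "n = length W + 2") (auto simp: numeral_eq_Suc)
      ultimately show ?thesis using nu_iter_within_cycle[OF less.prems 2(2)] 2(1) by auto
    next
      case 3
      have len: "length (W @ [0]) + 2 = length W + 3" by simp
      have "m' < m" "set (W @ [0]) \<subseteq> {0, 1}" using 3 less.prems by auto
      from less.IH[OF this, unfolded len]
      obtain \<delta> where \<delta>: "nu_iter (cycle_start (W @ [0])) m' = Some \<delta>"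
        "\<forall>n. size_Delta \<delta> \<le> n \<longleftrightarrow> length W + 3 \<le> n \<and> m' + tri (length W + 3) \<le> tri n"
        by blast
      have "length W + 3 \<le> n \<and> m' + tri (length W + 3) \<le> tri n \<longleftrightarrow>
          length W + 2 \<le> n \<and> m + tri (length W + 2) \<le> tri n" for n
        using 3 by (cases "n = length W + 2") (auto simp: numeral_eq_Suc)
      then show ?thesis
        using \<delta> nu_iter_add[OF nu_iter_whole_cycle[OF less.prems], of m'] 3 by auto
    qed
  qed
qed

text \<open>One step leads from the empty partition to the vector \<open>(0, 0)\<close>.\<close>
lemma tail_growth_Nil: "tail_growth 1 []"
  unfolding tail_growth_def
proof
  fix m
  show "\<exists>\<delta>. nu_iter [] m = Some \<delta> \<and> (\<forall>n. size_Delta \<delta> \<le> n \<longleftrightarrow> 1 \<le> n \<and> m + tri 1 \<le> tri n)"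
  proof (cases m)
    case (Suc m')
    have "nu_iter [] 1 = Some (cycle_start [])" by (simp add: nu_iter_Suc nu_def cycle_start_def drop_zeros_def part_def)
    then have "nu_iter [] m = nu_iter (cycle_start []) m'" using nu_iter_add[of "[]" 1 _ m'] Suc by simp
    moreover obtain \<delta> where "nu_iter (cycle_start []) m' = Some \<delta>"
        "\<And>n. size_Delta \<delta> \<le> n \<longleftrightarrow> Suc (Suc 0) \<le> n \<and> Suc m' \<le> tri n"
      using tail_growth_cycle_start[of "[]"] by (auto simp: tail_growth_def numeral_2_eq_2)
    moreover have "Suc (Suc 0) \<le> n \<and> Suc m' \<le> tri n \<longleftrightarrow> 1 \<le> n \<and> m + tri 1 \<le> tri n" for n
      using Suc by (cases "n = 1") auto
    ultimately show ?thesis by auto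
  qed auto
qed

section \<open>Finding all initial partitions of given deficit\<close>

text \<open>Recursion equations by constructors, used for evaluation.\<close>

lemma hits_code [code]:
  "hits 0 \<gamma> = 0"
  "hits (Suc p) [] = (if p = 0 then 1 else 2)"
  "hits (Suc p) (x # \<gamma>) = (if x = p \<or> Suc x = p then 1 else 0) + hits p \<gamma>"
  using hits_le[of 0 \<gamma>] by auto

fun deficit :: "nat list \<Rightarrow> nat" where
  "deficit [] = 0"
| "deficit (p # \<gamma>) = (p - hits p \<gamma>) + deficit \<gamma>"

text \<open>The rows longer than the number of rows below them. Such a row may cost no deficit by itself.\<close>
fun overhang :: "nat list \<Rightarrow> nat" where
  "overhang [] = 0"
| "overhang (p # \<gamma>) = (if length \<gamma> < p then 1 else 0) + overhang \<gamma>"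

lemma psize_eq: "psize \<gamma> = row_dinv \<gamma> + deficit \<gamma>"
proof (induction \<gamma>)
  case (Cons p \<gamma>)
  then show ?case using hits_le[of p \<gamma>] by simp
qed simp

lemma defc_eq_deficit: "is_partition \<gamma> \<Longrightarrow> defc \<gamma> = int (deficit \<gamma>)"
  by (simp add: defc_def dinv_eq_row_dinv psize_eq)

lemma hits_less:
  "0 < p \<Longrightarrow> p \<le> length \<gamma> \<Longrightarrow> \<forall>x\<in>set \<gamma>. 0 < x \<Longrightarrow> hits p \<gamma> < p"
proof (induction \<gamma> arbitrary: p)
  case (Cons x \<gamma>)
  show ?case
  proof (cases "p = 1")
    case True
    then show ?thesis using Cons.prems hits_le[of 0 \<gamma>] by auto
  next
    case False
    then have "hits (p - 1) \<gamma> < p - 1" using Cons.IH[of "p - 1"] Cons.prems by auto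
    then show ?thesis by auto
  qed
qed simp

lemma part_1_le: "is_partition (p # \<gamma>) \<Longrightarrow> part \<gamma> 1 \<le> p"
  by (cases \<gamma>) (auto simp: is_partition_Cons part_Cons part_def)

text \<open>The numbers \<open>\<gamma>\<^sub>i + i\<close> rise by at most one per step, start at \<open>\<gamma>\<^sub>1 + 1\<close> and end above \<open>length \<gamma>\<close>. They
  therefore take every value in between, and those above \<open>q\<close> are counted neither by \<open>hits q\<close>, which
  counts values up to \<open>q\<close>, nor by \<open>overhang\<close>, which counts values above \<open>length \<gamma>\<close>.\<close>
lemma hits_overhang:
  assumes "is_partition \<gamma>" "q \<le> length \<gamma>"
  shows "hits q \<gamma> + overhang \<gamma> \<le> min (length \<gamma>) (max q (part \<gamma> 1))"
  using assms
proof (induction \<gamma> arbitrary: q)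
  case Nil
  then show ?case by simp
next
  case (Cons x \<gamma>)
  have g: "is_partition \<gamma>" "part \<gamma> 1 \<le> x"
    using Cons.prems(1) part_1_le by (auto simp: is_partition_Cons)
  have "q - 1 \<le> length \<gamma>" using Cons.prems(2) by auto
  from Cons.IH[OF g(1) this]
  have IH: "hits (q - 1) \<gamma> + overhang \<gamma> \<le> length \<gamma>"
    "hits (q - 1) \<gamma> + overhang \<gamma> \<le> max (q - 1) (part \<gamma> 1)" by simp_all
  have p1: "part (x # \<gamma>) 1 = x" by (simp add: part_Cons)
  have q: "q \<le> Suc (length \<gamma>)" using Cons.prems(2) by simp
  show ?case
    unfolding p1 using IH g(2) q by (auto simp: max_def split: if_splits)
qed

text \<open>The first row of an initial partition pays for all overhanging rows below it.\<close>
lemma closing_row_deficit: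
  assumes "is_partition (p # \<gamma>)" "p \<le> length \<gamma>"
  shows "overhang \<gamma> \<le> p - hits p \<gamma>"
  using hits_overhang[of \<gamma> p] part_1_le[OF assms(1)] assms by (simp add: is_partition_Cons) linarith

lemma row_cost:
  assumes "is_partition (ys @ \<sigma>)"
  shows "deficit \<sigma> + overhang \<sigma> + length ys \<le> deficit (ys @ \<sigma>) + overhang (ys @ \<sigma>)"
  using assms
proof (induction ys)
  case (Cons y ys)
  have "1 \<le> (y - hits y (ys @ \<sigma>)) + (if length (ys @ \<sigma>) < y then 1 else 0)"
    using hits_less[of y "ys @ \<sigma>"] Cons.prems by (auto simp: is_partition_def)
  then show ?case using Cons by (simp add: is_partition_Cons)
qed simp

text \<open>A suffix \<open>\<sigma>\<close> of an initial partition, with \<open>deficit \<sigma> + overhang \<sigma>\<close> and \<open>deficit \<sigma>\<close>.\<close>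
type_synonym stem = "nat list \<times> nat \<times> nat"

fun grow :: "stem \<Rightarrow> nat \<Rightarrow> stem" where
  "grow (\<sigma>, c, d) p = (let e = p - hits p \<sigma>
     in (p # \<sigma>, c + e + (if length \<sigma> < p then 1 else 0), d + e))"

text \<open>Each row still to come costs one more unit, except the closing first row. Since the length has
  to exceed all parts, at least \<open>hd \<sigma> - length \<sigma>\<close> such rows follow.\<close>
fun viable :: "nat \<Rightarrow> stem \<Rightarrow> bool" where
  "viable K (\<sigma>, c, d) \<longleftrightarrow> c + (hd \<sigma> - length \<sigma>) \<le> K"

fun closes :: "nat \<Rightarrow> stem \<Rightarrow> nat \<Rightarrow> bool" where
  "closes K (\<sigma>, c, d) p \<longleftrightarrow> d + (p - hits p \<sigma>) = K"

text \<open>A row of length \<open>p\<close> raises the cost \<open>c\<close> by at least one, so a viable stem has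
  \<open>p \<le> K - c + length \<sigma>\<close>.\<close>
fun extend :: "nat \<Rightarrow> stem \<Rightarrow> stem list" where
  "extend K (\<sigma>, c, d) =
     filter (viable K) (map (grow (\<sigma>, c, d)) [max 1 (part \<sigma> 1)..<Suc (K - c + length \<sigma>)])"

definition close :: "nat \<Rightarrow> stem \<Rightarrow> nat list list" where
  "close K s = map (\<lambda>p. p # fst s) (filter (closes K s) [max 1 (part (fst s) 1)..<Suc (length (fst s))])"

primrec search :: "nat \<Rightarrow> nat \<Rightarrow> stem \<Rightarrow> nat list list" where
  "search K 0 s = close K s"
| "search K (Suc n) s = close K s @ concat (map (search K n) (extend K s))"

definition initials :: "nat \<Rightarrow> nat list list" where
  "initials K = (if K = 0 then [[]] else []) @ search K K ([], 0, 0)"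

lemma search_complete:
  assumes "is_partition (p # ys @ \<sigma>)" "p \<le> length (ys @ \<sigma>)" "deficit (p # ys @ \<sigma>) = K"
    "length ys \<le> n"
  shows "p # ys @ \<sigma> \<in> set (search K n (\<sigma>, deficit \<sigma> + overhang \<sigma>, deficit \<sigma>))"
  using assms
proof (induction ys arbitrary: n \<sigma> rule: rev_induct)
  case Nil
  have "part \<sigma> 1 \<le> p" using Nil.prems(1) part_1_le by simp
  then have "p # \<sigma> \<in> set (close K (\<sigma>, deficit \<sigma> + overhang \<sigma>, deficit \<sigma>))"
    using Nil.prems
    by (auto simp: close_def is_partition_Cons simp del: upt_Suc intro!: image_eqI[of _ _ p])
  then show ?case by (cases n) auto
next
  case (snoc q ys)
  obtain n' where n: "n = Suc n'" "length ys \<le> n'" using snoc.prems(4) by (cases n) auto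
  have ass: "(ys @ [q]) @ \<sigma> = ys @ q # \<sigma>" by simp
  have part: "is_partition (ys @ q # \<sigma>)" "is_partition (q # \<sigma>)" "q \<le> p"
    using snoc.prems(1) by (auto simp: is_partition_def sorted_wrt_append)
  have "deficit (ys @ q # \<sigma>) + overhang (ys @ q # \<sigma>) \<le> K"
    using closing_row_deficit[of p "ys @ q # \<sigma>"] snoc.prems(1,2,3) unfolding ass by simp
  then have cost: "deficit (q # \<sigma>) + overhang (q # \<sigma>) + length ys \<le> K"
    using row_cost[OF part(1)] by simp
  have "Suc (deficit \<sigma> + overhang \<sigma>) \<le> deficit (q # \<sigma>) + overhang (q # \<sigma>)"
    using row_cost[of "[q]" \<sigma>] part(2) by simp
  then have range: "q \<in> set [max 1 (part \<sigma> 1)..<Suc (K - (deficit \<sigma> + overhang \<sigma>) + length \<sigma>)]"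
    using cost snoc.prems(2) part part_1_le[OF part(2)] by (auto simp: is_partition_Cons)
  let ?s = "(\<sigma>, deficit \<sigma> + overhang \<sigma>, deficit \<sigma>)"
  let ?t = "(q # \<sigma>, deficit (q # \<sigma>) + overhang (q # \<sigma>), deficit (q # \<sigma>))"
  have "grow ?s q = ?t" by (simp add: Let_def)
  moreover have "viable K ?t" using cost snoc.prems(2) part(3) by simp
  ultimately have "?t \<in> set (extend K ?s)"
    unfolding extend.simps set_filter set_map using range by (metis (no_types, lifting) imageI mem_Collect_eq)
  moreover have "p # ys @ q # \<sigma> \<in>
      set (search K n' (q # \<sigma>, deficit (q # \<sigma>) + overhang (q # \<sigma>), deficit (q # \<sigma>)))"
    using snoc.IH[of "q # \<sigma>"] snoc.prems(1-3) n(2) unfolding ass by blast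
  ultimately have "p # ys @ q # \<sigma> \<in>
      set (search K (Suc n') (\<sigma>, deficit \<sigma> + overhang \<sigma>, deficit \<sigma>))"
    unfolding search.simps set_append set_concat set_map by blast
  then show ?case using n by simp
qed

lemma initials_complete:
  assumes "is_partition \<gamma>" "initial \<gamma>" "defc \<gamma> = int K"
  shows "\<gamma> \<in> set (initials K)"
proof (cases \<gamma>)
  case Nil
  then show ?thesis using assms by (simp add: defc_eq_deficit initials_def)
next
  case (Cons p \<sigma>)
  have K: "deficit (p # \<sigma>) = K" "is_partition (p # \<sigma>)" "p \<le> length \<sigma>"
    using assms Cons by (auto simp: defc_eq_deficit initial_def)
  have "overhang \<sigma> \<le> p - hits p \<sigma>" using closing_row_deficit K by blast
  moreover have "length \<sigma> \<le> deficit \<sigma> + overhang \<sigma>"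
    using row_cost[of \<sigma> "[]"] K(2) by (simp add: is_partition_Cons)
  ultimately have "length \<sigma> \<le> K" using K(1) by simp
  then have "p # \<sigma> \<in> set (search K K ([], 0, 0))"
    using search_complete[of p \<sigma> "[]"] K by simp
  then show ?thesis by (simp add: initials_def Cons)
qed

section \<open>Chains built from orbits\<close>

text \<open>The reversal in the definition of \<open>TI\<close> matches that of \<open>stair\<close>, and the two leading zeros of the
  vector make \<open>TI \<mu>\<close> the start of a cycle.\<close>

lemma tail_growth_TI:
  assumes "is_partition \<mu>"
  shows "tail_growth (part \<mu> 1 + length \<mu> + 1) (TI \<mu>)"
proof (cases \<mu>)
  case Nil
  then show ?thesis using tail_growth_Nil by (simp add: TI_def part_def)
next
  case (Cons x \<nu>)
  define m where "m = part \<mu> 1"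
  define N where "N = m + length \<mu> + 1"
  have m: "0 < m" using assms Cons by (simp add: m_def is_partition_def part_Cons)
  have range: "set \<mu> \<subseteq> set [1..<Suc m]"
  proof
    fix y assume "y \<in> set \<mu>"
    then have "0 < y" "y \<le> m" using assms part_le_hd[OF assms] by (auto simp: m_def is_partition_def)
    then show "y \<in> set [1..<Suc m]" by auto
  qed
  have len: "length (TI_vec \<mu>) = N"
  proof -
    have "length (TI_vec \<mu>) = Suc (\<Sum>i\<leftarrow>[1..<Suc m]. Suc (count_list \<mu> i))"
      by (simp add: TI_vec_def length_concat comp_def m_def del: upt_Suc)
    also have "\<dots> = Suc (\<Sum>i\<in>set [1..<Suc m]. Suc (count_list \<mu> i))"
      by (subst sum_list_distinct_conv_sum_set) simp_all
    also have "\<dots> = Suc (m + (\<Sum>i\<in>set [1..<Suc m]. count_list \<mu> i))"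
      by (subst sum_Suc) (simp del: upt_Suc)
    also have "(\<Sum>i\<in>set [1..<Suc m]. count_list \<mu> i) = length \<mu>"
      by (rule sum_count_set) (use range in auto)
    finally show ?thesis by (simp add: N_def)
  qed
  obtain W where W: "TI_vec \<mu> = 0 # 0 # W" "set W \<subseteq> {0, 1}"
  proof -
    have "[1..<Suc m] = 1 # [2..<Suc m]" using m by (simp add: upt_conv_Cons numeral_2_eq_2 del: upt_Suc)
    then have "TI_vec \<mu> = 0 # 0 # replicate (count_list \<mu> 1) 1 @
        concat (map (\<lambda>i. 0 # replicate (count_list \<mu> i) 1) [2..<Suc m])"
      unfolding TI_vec_def m_def[symmetric] by (simp del: upt_Suc)
    then show thesis by (rule that) (auto split: if_splits)
  qed
  have st: "stair 0 (rev v) = map (\<lambda>i. i - 1 - part v i) (rev [1..<Suc (length v)])" for v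
  proof (induction v rule: rev_induct)
    case (snoc x v)
    have "map (\<lambda>i. i - 1 - part (v @ [x]) i) (rev [1..<Suc (length v)]) =
        map (\<lambda>i. i - 1 - part v i) (rev [1..<Suc (length v)])"
      by (rule map_cong) (auto simp: part_def nth_append)
    then show ?case using snoc by (simp add: part_def nth_append)
  qed simp
  have TI: "TI \<mu> = drop_zeros (stair 0 (rev (TI_vec \<mu>)))"
    using Cons len by (simp add: TI_def Let_def st m_def N_def del: upt_Suc)
  have "TI \<mu> = drop_zeros (stair 1 (rev (0 # W)))"
    by (simp add: TI W stair_append drop_zeros_append drop_zeros_Cons)
  also have "\<dots> = cycle_start W"
    unfolding cycle_start_def by (rule drop_zeros_id, rule stair_pos_hd) (use W in auto)
  finally show ?thesis
    using tail_growth_cycle_start[OF W(2)] len W(1) by (simp add: N_def m_def)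
qed

fun parts :: "nat \<Rightarrow> nat \<Rightarrow> nat list list" where
  "parts 0 n = (if n = 0 then [[]] else [])"
| "parts (Suc m) n = (if Suc m \<le> n then map (Cons (Suc m)) (parts (Suc m) (n - Suc m)) else [])
     @ parts m n"

lemma set_parts: "set (parts m n) = {\<gamma>. is_partition \<gamma> \<and> part \<gamma> 1 \<le> m \<and> psize \<gamma> = n}"
proof (induction m n rule: parts.induct)
  case (1 n)
  have "is_partition \<gamma> \<and> part \<gamma> 1 \<le> 0 \<and> psize \<gamma> = n \<longleftrightarrow> \<gamma> = [] \<and> n = 0" for \<gamma>
    by (cases \<gamma>) (auto simp: is_partition_Cons part_Cons part_def)
  then show ?case by simp
next
  case (2 m n)
  have split: "{\<gamma>. is_partition \<gamma> \<and> part \<gamma> 1 \<le> Suc m \<and> psize \<gamma> = n} =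
    {\<gamma>. is_partition \<gamma> \<and> part \<gamma> 1 = Suc m \<and> psize \<gamma> = n} \<union>
    {\<gamma>. is_partition \<gamma> \<and> part \<gamma> 1 \<le> m \<and> psize \<gamma> = n}" by auto
  have "{\<gamma>. is_partition \<gamma> \<and> part \<gamma> 1 = Suc m \<and> psize \<gamma> = n} =
    (if Suc m \<le> n then Cons (Suc m) `
      {\<gamma>. is_partition \<gamma> \<and> part \<gamma> 1 \<le> Suc m \<and> psize \<gamma> = n - Suc m} else {})" (is "?A = ?B")
  proof (rule set_eqI)
    fix \<gamma>
    show "\<gamma> \<in> ?A \<longleftrightarrow> \<gamma> \<in> ?B"
    proof (cases \<gamma>)
      case (Cons x \<delta>)
      have "(\<forall>y\<in>set \<delta>. y \<le> x) \<longleftrightarrow> part \<delta> 1 \<le> x" if "is_partition \<delta>"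
      proof (cases \<delta>)
        case (Cons z \<epsilon>)
        then have "\<forall>y\<in>set \<epsilon>. y \<le> z" using that by (simp add: is_partition_Cons)
        then have "z \<le> x \<Longrightarrow> \<forall>y\<in>set \<epsilon>. y \<le> x" using order_trans by blast
        then show ?thesis by (auto simp: Cons part_Cons)
      qed (simp add: part_def)
      then show ?thesis by (auto simp: Cons is_partition_Cons part_Cons)
    qed (auto simp: part_def)
  qed
  then show ?case unfolding split parts.simps(2)[of m n] using 2 by (simp del: parts.simps)
qed

lemma Par_eq_parts: "Par k = set (parts k k)"
proof -
  have "part \<gamma> 1 \<le> psize \<gamma>" for \<gamma> by (cases \<gamma>) (auto simp: part_Cons part_def)
  then show ?thesis by (auto simp: set_parts Par_def)
qed

text \<open>The elements of a finite orbit, or \<open>None\<close> if it has more than \<open>n\<close> elements.\<close>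
fun segment :: "nat \<Rightarrow> nat list \<Rightarrow> nat list list option" where
  "segment 0 \<gamma> = None"
| "segment (Suc n) \<gamma> = (case nu \<gamma> of None \<Rightarrow> Some [\<gamma>] | Some \<delta> \<Rightarrow> map_option (Cons \<gamma>) (segment n \<delta>))"

lemma nu_iter_Suc': "nu_iter \<gamma> (Suc m) = Option.bind (nu \<gamma>) (\<lambda>\<delta>. nu_iter \<delta> m)"
proof (cases "nu \<gamma>")
  case None
  have "nu_iter \<gamma> (Suc m) = None" by (induction m) (use None in \<open>auto simp: nu_iter_Suc\<close>)
  then show ?thesis using None by simp
next
  case (Some \<delta>)
  then have "nu_iter \<gamma> 1 = Some \<delta>" by (simp add: nu_iter_Suc)
  from nu_iter_add[OF this, of m] show ?thesis using Some by simp
qed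

lemma orbit_unfold: "orbit \<gamma> = insert \<gamma> (case nu \<gamma> of None \<Rightarrow> {} | Some \<delta> \<Rightarrow> orbit \<delta>)"
proof -
  have "(\<exists>m. nu_iter \<gamma> m = Some \<epsilon>) \<longleftrightarrow> \<epsilon> = \<gamma> \<or> (\<exists>m. nu_iter \<gamma> (Suc m) = Some \<epsilon>)" for \<epsilon>
    by (metis not0_implies_Suc nu_iter_0 option.inject)
  then show ?thesis
    unfolding orbit_def nu_iter_Suc' by (cases "nu \<gamma>") auto
qed

lemma set_segment: "segment n \<gamma> = Some L \<Longrightarrow> set L = orbit \<gamma>"
proof (induction n arbitrary: \<gamma> L)
  case (Suc n)
  show ?case unfolding orbit_unfold[of \<gamma>] using Suc by (auto split: option.splits)
qed simp

text \<open>A partition \<open>\<mu>\<close>, its partner, and the initial partitions of the finite orbits in the chain of \<open>\<mu>\<close>.\<close>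
type_synonym chain_data = "nat list \<times> nat list \<times> nat list list"

definition seed :: "nat \<Rightarrow> nat list \<Rightarrow> bool" where
  "seed k \<gamma> \<longleftrightarrow> is_partition \<gamma> \<and> initial \<gamma> \<and> psize \<gamma> = row_dinv \<gamma> + k"

lemma seedD: "seed k \<gamma> \<Longrightarrow> is_partition \<gamma> \<and> initial \<gamma> \<and> defc \<gamma> = int k"
  by (simp add: seed_def defc_def dinv_eq_row_dinv)

text \<open>The bound 60 exceeds the length of every finite orbit that occurs; the longest has 45 elements.\<close>
definition segments :: "nat list list \<Rightarrow> nat list list" where
  "segments F = concat (map (\<lambda>\<gamma>. the (segment 60 \<gamma>)) F)"

definition width :: "nat list \<Rightarrow> nat" where
  "width \<mu> = part \<mu> 1 + length \<mu> + 1"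

definition seeds :: "chain_data \<Rightarrow> nat list list" where
  "seeds = (\<lambda>(\<mu>, s, F). F @ [TI \<mu>])"

definition head_sizes :: "chain_data \<Rightarrow> nat list" where
  "head_sizes = (\<lambda>(\<mu>, s, F). map size_Delta (segments F))"

text \<open>The third condition says that the dinv values of the finite orbits, in order, fill the
  gap between the length of the partner and the start of the tail. The last one makes the symmetry hold in
  \<open>DP n\<close> for large \<open>n\<close>: it says that \<open>TI \<mu>\<close> has area \<open>length \<mu>\<close> in its staircase.\<close>
definition chain_ok :: "nat \<Rightarrow> chain_data \<Rightarrow> bool" where
  "chain_ok k = (\<lambda>(\<mu>, s, F).
     list_all (seed k) (F @ [TI \<mu>]) \<and>
     list_all (\<lambda>\<gamma>. segment 60 \<gamma> \<noteq> None) F \<and>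
     map row_dinv (segments F) @ [row_dinv (TI \<mu>)] = [length s..<Suc (row_dinv (TI \<mu>))] \<and>
     row_dinv (TI \<mu>) + k + length \<mu> = tri (width \<mu>))"

text \<open>The entry at position \<open>i\<close> tells whether the chain element with dinv \<open>i\<close> lies in \<open>DP n\<close>.
  The first \<open>length s\<close> values do not occur, the list \<open>hs\<close> covers the finite orbits, and a
  final block comes from the tail.\<close>
definition levels :: "nat \<Rightarrow> nat list \<Rightarrow> nat list \<Rightarrow> nat list \<Rightarrow> bool list" where
  "levels n \<mu> s hs = replicate (length s) False @ map (\<lambda>d. d \<le> n) hs @
     (if width \<mu> \<le> n then replicate (Suc (tri n) - tri (width \<mu>)) True else [])"

locale chain =
  fixes k :: nat and \<mu> s :: "nat list" and F :: "nat list list"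
  assumes ok: "chain_ok k (\<mu>, s, F)" and mu: "is_partition \<mu>"
begin

text \<open>The tail starts at dinv value \<open>D\<close>, the finite orbits are listed in \<open>L\<close>, the element with dinv \<open>i\<close>
  is \<open>c i\<close>, and further below \<open>A n\<close> is the set of dinv values that occur in \<open>DP n\<close>.\<close>
definition D :: nat where "D = row_dinv (TI \<mu>)"
definition L :: "nat list list" where "L = segments F"

definition C :: "nat list set" where "C = (\<Union>\<gamma>\<in>set (seeds (\<mu>, s, F)). orbit \<gamma>)"

definition c :: "nat \<Rightarrow> nat list" where
  "c i = (if i < D then L ! (i - length s) else the (nu_iter (TI \<mu>) (i - D)))"

lemma seeds_props: "\<gamma> \<in> set (seeds (\<mu>, s, F)) \<Longrightarrow> is_partition \<gamma> \<and> initial \<gamma> \<and> defc \<gamma> = int k"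
  using ok seedD by (auto simp: chain_ok_def list_all_iff seeds_def)

lemma C_props: "\<gamma> \<in> C \<Longrightarrow> is_partition \<gamma> \<and> defc \<gamma> = int k"
proof -
  assume "\<gamma> \<in> C"
  then obtain \<gamma>0 where "\<gamma>0 \<in> set (seeds (\<mu>, s, F))" "\<gamma> \<in> orbit \<gamma>0" by (auto simp: C_def)
  then show ?thesis using seeds_props[of \<gamma>0] orbit_partition[of \<gamma>0 \<gamma>] orbit_defc[of \<gamma>0 \<gamma>] by simp
qed

lemma map_dinv_L: "map row_dinv L = [length s..<D]" and D_eq: "D = length s + length L"
proof -
  have *: "map row_dinv L @ [D] = [length s..<Suc D]" using ok by (simp add: chain_ok_def D_def L_def)
  then have "length s \<le> D" by (cases "length s \<le> D") auto
  then show 1: "map row_dinv L = [length s..<D]" using * by simp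
  have "length L = length (map row_dinv L)" by simp
  also have "\<dots> = D - length s" by (simp only: 1 length_upt)
  finally have "length L = D - length s" .
  then show "D = length s + length L" using \<open>length s \<le> D\<close> by simp
qed

lemma set_L: "set L = (\<Union>\<gamma>\<in>set F. orbit \<gamma>)"
proof -
  have "set (the (segment 60 \<gamma>)) = orbit \<gamma>" if "\<gamma> \<in> set F" for \<gamma>
    using ok that set_segment[of 60 \<gamma>] by (auto simp: chain_ok_def list_all_iff)
  then show ?thesis by (simp add: L_def segments_def)
qed

lemma C_eq: "C = set L \<union> orbit (TI \<mu>)"
  by (auto simp: C_def seeds_def set_L)

lemma tail: "\<exists>\<delta>. nu_iter (TI \<mu>) m = Some \<delta> \<and>
    (\<forall>n. size_Delta \<delta> \<le> n \<longleftrightarrow> width \<mu> \<le> n \<and> m + tri (width \<mu>) \<le> tri n)"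
  using tail_growth_TI[OF mu] by (simp add: tail_growth_def width_def)

lemma image_c: "C = c ` {length s..}"
proof -
  have "c ` {length s..<D} = set L"
  proof (intro equalityI subsetI)
    fix x assume "x \<in> c ` {length s..<D}"
    then show "x \<in> set L" using D_eq by (auto simp: c_def)
  next
    fix x assume "x \<in> set L"
    then obtain j where "j < length L" "x = L ! j" by (auto simp: in_set_conv_nth)
    then show "x \<in> c ` {length s..<D}"
      using D_eq by (intro image_eqI[of _ _ "length s + j"]) (auto simp: c_def)
  qed
  moreover have "c ` {D..} = orbit (TI \<mu>)"
  proof (intro equalityI subsetI)
    fix x assume "x \<in> c ` {D..}"
    then obtain i where i: "D \<le> i" "x = c i" by auto
    obtain \<delta> where "nu_iter (TI \<mu>) (i - D) = Some \<delta>" using tail by blast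
    then show "x \<in> orbit (TI \<mu>)" using i by (auto simp: c_def orbit_def)
  next
    fix x assume "x \<in> orbit (TI \<mu>)"
    then obtain m where "nu_iter (TI \<mu>) m = Some x" by (auto simp: orbit_def)
    then show "x \<in> c ` {D..}" by (intro image_eqI[of _ _ "D + m"]) (auto simp: c_def)
  qed
  moreover have "{length s..} = {length s..<D} \<union> {D..}" using D_eq by auto
  ultimately show ?thesis by (simp add: C_eq image_Un)
qed

lemma dinv_c:
  assumes "length s \<le> i"
  shows "dinv (c i) = i"
proof (cases "i < D")
  case True
  have "c i \<in> C" using assms by (simp add: image_c)
  then have "dinv (c i) = row_dinv (c i)" using C_props dinv_eq_row_dinv by blast
  also have "\<dots> = map row_dinv L ! (i - length s)" using True assms by (simp add: c_def D_eq)
  also have "\<dots> = i" using True assms by (simp add: map_dinv_L)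
  finally show ?thesis .
next
  case False
  obtain \<delta> where \<delta>: "nu_iter (TI \<mu>) (i - D) = Some \<delta>" using tail by blast
  have "is_partition (TI \<mu>)" using seeds_props[of "TI \<mu>"] by (simp add: seeds_def)
  with \<delta> have "dinv \<delta> = D + (i - D)" using nu_iter_props dinv_eq_row_dinv by (simp add: D_def)
  then show ?thesis using False \<delta> by (simp add: c_def)
qed

lemma psize_c:
  assumes "length s \<le> i"
  shows "psize (c i) = i + k"
  using C_props[of "c i"] dinv_c[OF assms] assms by (auto simp: image_c defc_def)

definition A :: "nat \<Rightarrow> nat set" where "A n = {i. length s \<le> i \<and> size_Delta (c i) \<le> n}"

lemma A_iff:
  defines "hs \<equiv> head_sizes (\<mu>, s, F)"
  shows "i \<in> A n \<longleftrightarrow> (length s \<le> i \<and> i < D \<and> hs ! (i - length s) \<le> n) \<or>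
    (width \<mu> \<le> n \<and> D \<le> i \<and> i < D + (Suc (tri n) - tri (width \<mu>)))"
    and "D = length s + length hs"
proof -
  have hs: "hs = map size_Delta L" by (simp add: hs_def head_sizes_def L_def)
  show "D = length s + length hs" by (simp add: hs D_eq)
  show "i \<in> A n \<longleftrightarrow> (length s \<le> i \<and> i < D \<and> hs ! (i - length s) \<le> n) \<or>
    (width \<mu> \<le> n \<and> D \<le> i \<and> i < D + (Suc (tri n) - tri (width \<mu>)))"
  proof (cases "i < D")
    case True
    then show ?thesis by (auto simp: A_def c_def hs D_eq)
  next
    case False
    obtain \<delta> where \<delta>: "nu_iter (TI \<mu>) (i - D) = Some \<delta>"
      "size_Delta \<delta> \<le> n \<longleftrightarrow> width \<mu> \<le> n \<and> (i - D) + tri (width \<mu>) \<le> tri n" using tail by blast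
    then show ?thesis using False D_eq tri_mono[of "width \<mu>" n] by (auto simp: A_def c_def)
  qed
qed

lemma A_eq:
  defines "xs n \<equiv> levels n \<mu> s (head_sizes (\<mu>, s, F))"
  shows "A n = {i. i < length (xs n) \<and> xs n ! i}"
proof (rule set_eqI)
  fix i
  show "i \<in> A n \<longleftrightarrow> i \<in> {i. i < length (xs n) \<and> xs n ! i}"
    unfolding A_iff(1) A_iff(2) xs_def levels_def
    by (auto simp: nth_append)
qed

lemma Cat_eq: "Cat n C q t = (\<Sum>i\<in>A n. q ^ (tri n - (i + k)) * t ^ i)"
proof -
  have "C \<inter> DP n = c ` A n"
    using C_props by (auto simp: image_c DP_def A_def min_Delta_eq_size_Delta)
  moreover have "inj_on c (A n)" by (rule inj_on_inverseI[of _ dinv]) (simp add: A_def dinv_c)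
  ultimately have "Cat n C q t = (\<Sum>i\<in>A n. q ^ ((n choose 2) - psize (c i)) * t ^ dinv (c i))"
    by (simp add: Cat_def sum.reindex)
  also have "\<dots> = (\<Sum>i\<in>A n. q ^ (tri n - (i + k)) * t ^ i)"
    by (rule sum.cong) (auto simp: A_def psize_c dinv_c tri_eq_choose)
  finally show ?thesis .
qed

lemma A_large:
  assumes "\<forall>d\<in>set (head_sizes (\<mu>, s, F)). d \<le> n" "width \<mu> \<le> n"
  shows "A n = {i. length s \<le> i \<and> i + k + length \<mu> \<le> tri n}"
proof -
  have "i \<in> A n \<longleftrightarrow> length s \<le> i \<and> i + k + length \<mu> \<le> tri n" for i
  proof -
    define hs where "hs = head_sizes (\<mu>, s, F)"
    have D: "D = length s + length hs" using A_iff(2) by (simp add: hs_def)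
    have "hs ! (i - length s) \<le> n" if "length s \<le> i" "i < D"
      using assms(1) that D by (simp add: hs_def)
    moreover have "D + k + length \<mu> = tri (width \<mu>)" using ok by (simp add: chain_ok_def D_def)
    moreover have "tri (width \<mu>) \<le> tri n" using assms(2) by (rule tri_mono)
    ultimately show ?thesis using assms(2) D
      unfolding A_iff(1) hs_def[symmetric] by linarith
  qed
  then show ?thesis by blast
qed

end

text \<open>Restriction to the first \<open>m\<close> positions, padded to length \<open>m\<close>. With \<open>m = (n choose 2) - k + 1\<close>,
  reversal of a trimmed list is the reflection \<open>i \<mapsto> (n choose 2) - k - i\<close>.\<close>
definition trim :: "nat \<Rightarrow> bool list \<Rightarrow> bool list" where
  "trim m xs = take m (xs @ replicate m False)"

definition mirrored :: "nat \<Rightarrow> bool list \<Rightarrow> bool list \<Rightarrow> bool" where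
  "mirrored m xs ys \<longleftrightarrow> list_all Not (drop m xs) \<and> list_all Not (drop m ys) \<and> trim m xs = rev (trim m ys)"

lemma mirrored_sym: "mirrored m xs ys \<Longrightarrow> mirrored m ys xs"
  by (auto simp: mirrored_def)

lemma mirroredD:
  assumes "mirrored m xs ys" "i < length xs" "xs ! i"
  shows "i < m" "m - Suc i < length ys" "ys ! (m - Suc i)"
proof -
  have len: "length (trim m zs) = m" for zs by (simp add: trim_def)
  have nth: "trim m zs ! j \<longleftrightarrow> j < length zs \<and> zs ! j" if "j < m" for zs j
    using that by (auto simp: trim_def nth_append)
  show "i < m"
  proof (rule ccontr)
    assume "\<not> i < m"
    then have "i - m < length (drop m xs)" "drop m xs ! (i - m)" using assms(2,3) by auto
    then show False using assms(1) by (auto simp: mirrored_def list_all_length)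
  qed
  then have "trim m ys ! (m - Suc i)"
    using assms nth[of i xs] len[of ys] by (auto simp: mirrored_def rev_nth)
  then show "m - Suc i < length ys" "ys ! (m - Suc i)" using nth[of "m - Suc i" ys] \<open>i < m\<close> by auto
qed

text \<open>A chain element with dinv \<open>i\<close> has size \<open>i + k\<close>, so its exponents are \<open>(n choose 2) - k - i\<close> and \<open>i\<close>, and exchanging
  \<open>q\<close> and \<open>t\<close> amounts to reflecting the set of dinv values.\<close>
lemma Cat_mirror:
  assumes "chain k \<mu> s F" "chain k s \<mu> F'"
    "\<forall>d\<in>set (head_sizes (\<mu>, s, F)) \<union> set (head_sizes (s, \<mu>, F')). d \<le> n0"
    "width \<mu> \<le> n0" "width s \<le> n0"
    "\<And>n. n < n0 \<Longrightarrow> mirrored (Suc (tri n) - k)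
       (levels n \<mu> s (head_sizes (\<mu>, s, F))) (levels n s \<mu> (head_sizes (s, \<mu>, F')))"
  shows "Cat n (chain.C \<mu> s F) q t = Cat n (chain.C s \<mu> F') t q"
proof -
  interpret X: chain k \<mu> s F by fact
  interpret Y: chain k s \<mu> F' by fact
  have XY: "(\<forall>i\<in>X.A n. \<exists>j\<in>Y.A n. i + j + k = tri n) \<and> (\<forall>j\<in>Y.A n. \<exists>i\<in>X.A n. i + j + k = tri n)"
  proof (cases "n < n0")
    case True
    note m = assms(6)[OF True]
    have "\<exists>j\<in>Y.A n. i + j + k = tri n" if "i \<in> X.A n" for i
      using mirroredD[OF m, of i] that
      by (intro bexI[of _ "Suc (tri n) - k - Suc i"]) (auto simp: X.A_eq Y.A_eq)
    moreover have "\<exists>i\<in>X.A n. i + j + k = tri n" if "j \<in> Y.A n" for j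
      using mirroredD[OF mirrored_sym[OF m], of j] that
      by (intro bexI[of _ "Suc (tri n) - k - Suc j"]) (auto simp: X.A_eq Y.A_eq)
    ultimately show ?thesis by blast
  next
    case False
    then have x: "X.A n = {i. length s \<le> i \<and> i + k + length \<mu> \<le> tri n}"
      and y: "Y.A n = {i. length \<mu> \<le> i \<and> i + k + length s \<le> tri n}"
      using assms(3-5) by (auto intro!: X.A_large Y.A_large intro: order_trans)
    have mid: "\<exists>j\<in>{j. a \<le> j \<and> j + k + b \<le> tri n}. i + j + k = tri n"
      if "b \<le> i" "i + k + a \<le> tri n" for i a b
      by (rule bexI[of _ "tri n - k - i"]) (use that in auto)
    have "\<exists>j\<in>Y.A n. i + j + k = tri n" if "i \<in> X.A n" for i
      unfolding y by (rule mid) (use that x in auto)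
    moreover have "\<exists>i\<in>X.A n. i + j + k = tri n" if "j \<in> Y.A n" for j
    proof -
      have "\<exists>i\<in>X.A n. j + i + k = tri n" unfolding x by (rule mid) (use that y in auto)
      then show ?thesis by (simp add: add.commute)
    qed
    ultimately show ?thesis by blast
  qed
  have c1: "i + k \<le> tri n \<and> tri n - k - i \<in> Y.A n" if i: "i \<in> X.A n" for i
  proof -
    obtain j where "j \<in> Y.A n" "i + j + k = tri n" using XY i by blast
    moreover from this have "tri n - k - i = j" by simp
    ultimately show ?thesis by simp
  qed
  have c2: "j + k \<le> tri n \<and> tri n - k - j \<in> X.A n" if j: "j \<in> Y.A n" for j
  proof -
    obtain i where "i \<in> X.A n" "i + j + k = tri n" using XY j by blast
    moreover from this have "tri n - k - j = i" by simp
    ultimately show ?thesis by simp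
  qed
  show ?thesis unfolding X.Cat_eq Y.Cat_eq
  proof (rule sum.reindex_bij_witness[of _ "\<lambda>j. tri n - k - j" "\<lambda>i. tri n - k - i"])
    fix i assume "i \<in> X.A n"
    note i = c1[OF this]
    show "tri n - k - (tri n - k - i) = i" "tri n - k - i \<in> Y.A n" using i by auto
    have "tri n - (tri n - k - i + k) = i" "tri n - k - i = tri n - (i + k)" using i by auto
    then show "t ^ (tri n - (tri n - k - i + k)) * q ^ (tri n - k - i) = q ^ (tri n - (i + k)) * t ^ i"
      by (simp add: mult.commute)
  next
    fix j assume "j \<in> Y.A n"
    note j = c2[OF this]
    show "tri n - k - (tri n - k - j) = j" "tri n - k - j \<in> X.A n" using j by auto
  qed
qed

section \<open>Verified tables give the theorem\<close>

text \<open>Self-dual entries and pairs of partners are kept apart, so that the involution need not be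
  looked up.\<close>

type_synonym table = "(nat list \<times> nat list list) list \<times>
  ((nat list \<times> nat list list) \<times> (nat list \<times> nat list list)) list"

definition rows :: "table \<Rightarrow> chain_data list" where
  "rows = (\<lambda>(S, B). map (\<lambda>(\<mu>, F). (\<mu>, \<mu>, F)) S @
     concat (map (\<lambda>((\<mu>, F), (\<nu>, G)). [(\<mu>, \<nu>, F), (\<nu>, \<mu>, G)]) B))"

definition mirror_ok :: "nat \<Rightarrow> nat list \<Rightarrow> nat list \<Rightarrow> nat list \<Rightarrow> nat list \<Rightarrow> bool" where
  "mirror_ok k \<mu> hs \<nu> hs' \<longleftrightarrow>
     list_all (\<lambda>d. d \<le> k + 3) hs \<and> list_all (\<lambda>d. d \<le> k + 3) hs' \<and>
     width \<mu> \<le> k + 3 \<and> width \<nu> \<le> k + 3 \<and>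
     list_all (\<lambda>n. mirrored (Suc (tri n) - k) (levels n \<mu> \<nu> hs) (levels n \<nu> \<mu> hs')) [0..<k + 3]"

definition mirror_rows :: "nat \<Rightarrow> chain_data \<Rightarrow> chain_data \<Rightarrow> bool" where
  "mirror_rows k r r' = mirror_ok k (fst r) (head_sizes r) (fst r') (head_sizes r')"

text \<open>The filter, in a form whose evaluation by rewriting takes linear time.\<close>
definition sift :: "('a \<Rightarrow> bool) \<Rightarrow> 'a list \<Rightarrow> 'a list" where
  "sift P xs = concat (map (\<lambda>x. if P x then [x] else []) xs)"

text \<open>Distinctness, tested only between lists that fall on the same side of all cuts.\<close>
fun apart :: "(nat \<times> nat) list \<Rightarrow> nat list list \<Rightarrow> bool" where
  "apart [] xs = distinct xs"
| "apart ((i, c) # ps) xs =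
     (apart ps (sift (\<lambda>\<gamma>. part \<gamma> i \<le> c) xs) \<and> apart ps (sift (\<lambda>\<gamma>. \<not> part \<gamma> i \<le> c) xs))"

lemma apart_distinct: "apart ps xs \<Longrightarrow> distinct xs"
proof (induction ps xs rule: apart.induct)
  case (2 i c ps xs)
  have "distinct (sift P xs) \<Longrightarrow> distinct (sift (\<lambda>x. \<not> P x) xs) \<Longrightarrow> distinct xs"
    for P :: "nat list \<Rightarrow> bool"
    by (induction xs) (auto simp: sift_def split: if_splits)
  from this[of "\<lambda>\<gamma>. part \<gamma> i \<le> c"] show ?case using 2 by simp
qed simp

text \<open>Cuts that split the entries of the largest table evenly. Any list would be sound.\<close>
definition cuts :: "(nat \<times> nat) list" where
  "cuts = [(2, 5), (9, 0), (6, 1), (11, 0), (3, 3), (7, 1), (1, 5)]"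

text \<open>Completeness is verified by counting: the seeds are distinct initial partitions of deficit \<open>k\<close>, hence
  among those found by the search, and there are as many of them.\<close>
definition table_ok :: "nat \<Rightarrow> table \<Rightarrow> bool" where
  "table_ok k T \<longleftrightarrow>
     list_all (\<lambda>\<mu>. List.member (map fst (rows T)) \<mu>) (parts k k) \<and>
     list_all (\<lambda>(\<mu>, _). List.member (parts k k) \<mu>) (rows T) \<and>
     list_all (chain_ok k) (rows T) \<and>
     apart cuts (concat (map seeds (rows T))) \<and>
     length (concat (map seeds (rows T))) = length (initials k) \<and>
     list_all (\<lambda>(\<mu>, F). mirror_rows k (\<mu>, \<mu>, F) (\<mu>, \<mu>, F)) (fst T) \<and>
     list_all (\<lambda>((\<mu>, F), (\<nu>, G)). mirror_rows k (\<mu>, \<nu>, F) (\<nu>, \<mu>, G)) (snd T)"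

lemma distinct_concat_unique:
  "distinct (concat (map f T)) \<Longrightarrow> r \<in> set T \<Longrightarrow> r' \<in> set T \<Longrightarrow> x \<in> set (f r) \<Longrightarrow> x \<in> set (f r') \<Longrightarrow> r = r'"
  by (induction T) auto

lemma partner:
  assumes "table_ok k T" "r \<in> set (rows T)"
  shows "\<exists>r'\<in>set (rows T). fst r' = fst (snd r) \<and> fst (snd r') = fst r \<and> (mirror_rows k r r' \<or> mirror_rows k r' r)"
proof -
  obtain S B where T: "T = (S, B)" by (cases T)
  consider \<mu> F where "(\<mu>, F) \<in> set S" "r = (\<mu>, \<mu>, F)"
    | \<mu> F \<nu> G where "((\<mu>, F), (\<nu>, G)) \<in> set B" "r = (\<mu>, \<nu>, F) \<or> r = (\<nu>, \<mu>, G)"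
    using assms(2) by (auto simp: rows_def T)
  then show ?thesis
  proof cases
    case 1
    then have "mirror_rows k r r" using assms(1) by (auto simp: table_ok_def T list_all_iff)
    then show ?thesis using 1 assms(2) by (intro bexI[of _ r]) simp_all
  next
    case 2
    then have "mirror_rows k (\<mu>, \<nu>, F) (\<nu>, \<mu>, G)" using assms(1) by (auto simp: table_ok_def T list_all_iff)
    moreover have "(\<mu>, \<nu>, F) \<in> set (rows T)" "(\<nu>, \<mu>, G) \<in> set (rows T)"
      using 2(1) by (force simp: rows_def T)+
    ultimately show ?thesis
      using 2(2) bexI[of _ "(\<nu>, \<mu>, G)" "set (rows T)"] bexI[of _ "(\<mu>, \<nu>, F)" "set (rows T)"]
      by (elim disjE) simp_all
  qed
qed

text \<open>A row of the table is determined by its partition \<open>\<mu>\<close>, because \<open>TI \<mu>\<close> is one of its seeds and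
  the seeds of different rows are different. This is what makes the partner an involution
  and, orbits of different initial partitions being disjoint, the chains disjoint.\<close>
lemma table_sound:
  assumes "table_ok k T"
  shows "\<exists>(C :: nat list \<Rightarrow> nat list set) (star :: nat list \<Rightarrow> nat list).
    (\<forall>\<mu>\<in>Par k. \<forall>\<gamma>\<in>C \<mu>. is_partition \<gamma>) \<and>
    (\<forall>\<mu>\<in>Par k. star \<mu> \<in> Par k \<and> star (star \<mu>) = \<mu>) \<and>
    disjoint_family_on C (Par k) \<and>
    (\<forall>\<mu>\<in>Par k. \<forall>\<gamma>\<in>C \<mu>. defc \<gamma> = int (psize \<mu>) \<and> psize \<mu> = k) \<and>
    (\<forall>\<mu>\<in>Par k. \<exists>c :: nat \<Rightarrow> nat list.
        C \<mu> = c ` {length (star \<mu>)..} \<and> (\<forall>i\<ge>length (star \<mu>). dinv (c i) = i)) \<and>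
    (\<forall>\<gamma>\<in>Def k. \<exists>\<mu>\<in>Par k. \<gamma> \<in> C \<mu>) \<and>
    (\<forall>\<mu>\<in>Par k. tail \<mu> \<subseteq> C \<mu>) \<and>
    (\<forall>\<mu>\<in>Par k. \<forall>\<gamma>\<in>C \<mu>. \<forall>\<delta>. nu \<gamma> = Some \<delta> \<longrightarrow> \<delta> \<in> C \<mu>) \<and>
    (\<forall>n. \<forall>\<mu>\<in>Par k. Cat n (C \<mu>) var_q var_t = Cat n (C (star \<mu>)) var_t var_q)"
proof -
  define R where "R = rows T"
  define star where "star = (\<lambda>\<mu>. fst (the (map_of R \<mu>)))"
  define F where "F = (\<lambda>\<mu>. snd (the (map_of R \<mu>)))"
  define row where "row = (\<lambda>\<mu>. (\<mu>, star \<mu>, F \<mu>))"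
  define C where "C = (\<lambda>\<mu>. chain.C \<mu> (star \<mu>) (F \<mu>))"
  have ok: "\<And>r. r \<in> set R \<Longrightarrow> chain_ok k r" "Par k \<subseteq> fst ` set R" "fst ` set R \<subseteq> Par k"
    using assms by (auto simp: table_ok_def R_def list_all_iff Par_eq_parts)
  have dist: "distinct (concat (map seeds R))"
    using assms apart_distinct unfolding table_ok_def R_def by blast
  have row: "row \<mu> \<in> set R" if "\<mu> \<in> Par k" for \<mu>
  proof -
    have "map_of R \<mu> \<noteq> None" using ok(2) that by (auto simp: map_of_eq_None_iff)
    then have "map_of R \<mu> = Some (star \<mu>, F \<mu>)" by (auto simp: star_def F_def)
    then show ?thesis using map_of_SomeD[of R \<mu>] by (simp add: row_def)
  qed
  have chain: "chain k \<mu> (star \<mu>) (F \<mu>)" if "\<mu> \<in> Par k" for \<mu>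
    using ok(1)[OF row[OF that]] that by unfold_locales (auto simp: row_def Par_def)
  have C: "C \<mu> = (\<Union>\<gamma>\<in>set (seeds (row \<mu>)). orbit \<gamma>)" if "\<mu> \<in> Par k" for \<mu>
    using chain.C_def[OF chain[OF that]] by (simp add: C_def row_def)
  have seeds: "is_partition \<gamma> \<and> initial \<gamma> \<and> defc \<gamma> = int k" if "r \<in> set R" "\<gamma> \<in> set (seeds r)" for r \<gamma>
    using ok(1)[OF that(1)] that(2) seedD by (cases r) (auto simp: chain_ok_def seeds_def list_all_iff)
  have TI: "TI (fst r) \<in> set (seeds r)" for r by (cases r) (simp add: seeds_def)
  have unique: "r = row (fst r)" if "r \<in> set R" for r
  proof (rule distinct_concat_unique[OF dist that])
    show "row (fst r) \<in> set R" using row that ok(3) by blast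
    show "TI (fst r) \<in> set (seeds r)" by (rule TI)
    show "TI (fst r) \<in> set (seeds (row (fst r)))" using TI[of "row (fst r)"] by (simp add: row_def)
  qed
  have all_seeds: "set (concat (map seeds R)) = set (initials k)"
  proof (rule card_seteq)
    show "set (concat (map seeds R)) \<subseteq> set (initials k)"
      using seeds initials_complete by auto
    have "card (set (initials k)) \<le> length (initials k)" by (rule card_length)
    also have "\<dots> = card (set (concat (map seeds R)))"
      using assms distinct_card[OF dist] by (simp add: table_ok_def R_def)
    finally show "card (set (initials k)) \<le> card (set (concat (map seeds R)))" .
  qed simp
  have partner: "star \<mu> \<in> Par k \<and> star (star \<mu>) = \<mu> \<and>
      (mirror_rows k (row \<mu>) (row (star \<mu>)) \<or> mirror_rows k (row (star \<mu>)) (row \<mu>))"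
    if \<mu>: "\<mu> \<in> Par k" for \<mu>
  proof -
    obtain r where r: "r \<in> set R" "fst r = star \<mu>" "fst (snd r) = \<mu>"
      "mirror_rows k (row \<mu>) r \<or> mirror_rows k r (row \<mu>)"
      using partner[OF assms, of "row \<mu>"] row[OF \<mu>] by (auto simp: R_def row_def)
    then have "r = row (star \<mu>)" using unique[OF r(1)] by simp
    moreover have "star \<mu> \<in> Par k" using r(1,2) ok(3) by auto
    moreover have "star (star \<mu>) = \<mu>" using r(3) \<open>r = row (star \<mu>)\<close> by (simp add: row_def)
    ultimately show ?thesis using r(4) by simp
  qed
  then have star: "\<And>\<mu>. \<mu> \<in> Par k \<Longrightarrow> star \<mu> \<in> Par k"
    and star2: "\<And>\<mu>. \<mu> \<in> Par k \<Longrightarrow> star (star \<mu>) = \<mu>" by auto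
  have disj: "disjoint_family_on C (Par k)"
    unfolding disjoint_family_on_def
  proof (intro ballI impI)
    fix \<mu> \<nu> assume *: "\<mu> \<in> Par k" "\<nu> \<in> Par k" "\<mu> \<noteq> \<nu>"
    have "row \<mu> \<noteq> row \<nu>" using *(3) by (simp add: row_def)
    then have "\<gamma> \<noteq> \<gamma>'" if "\<gamma> \<in> set (seeds (row \<mu>))" "\<gamma>' \<in> set (seeds (row \<nu>))" for \<gamma> \<gamma>'
      using distinct_concat_unique[OF dist row row, of \<mu> \<nu> \<gamma>] *(1,2) that by blast
    then have "orbit \<gamma> \<inter> orbit \<gamma>' = {}"
      if "\<gamma> \<in> set (seeds (row \<mu>))" "\<gamma>' \<in> set (seeds (row \<nu>))" for \<gamma> \<gamma>'
      using that seeds[OF row[OF *(1)]] seeds[OF row[OF *(2)]] orbit_disjoint[of \<gamma> \<gamma>'] by blast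
    then show "C \<mu> \<inter> C \<nu> = {}" using *(1,2) by (fastforce simp: C)
  qed
  have cover: "\<exists>\<mu>\<in>Par k. \<gamma> \<in> C \<mu>" if \<gamma>: "\<gamma> \<in> Def k" for \<gamma>
  proof -
    obtain \<gamma>0 where g0: "is_partition \<gamma>0" "initial \<gamma>0" "\<gamma> \<in> orbit \<gamma>0"
      using \<gamma> ex_initial by (auto simp: Def_def)
    then have "\<gamma>0 \<in> set (initials k)"
      using \<gamma> orbit_defc by (intro initials_complete) (auto simp: Def_def)
    then obtain r where r: "r \<in> set R" "\<gamma>0 \<in> set (seeds r)"
      unfolding all_seeds[symmetric] by auto
    have k: "fst r \<in> Par k" using r(1) ok(3) by auto
    have "r = row (fst r)" by (rule unique[OF r(1)])
    then have "\<gamma> \<in> C (fst r)" using C[OF k] r(2) g0(3) by auto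
    then show ?thesis using k by blast
  qed
  have Cat: "Cat n (C \<mu>) q t = Cat n (C (star \<mu>)) t q" if \<mu>: "\<mu> \<in> Par k" for n \<mu> and q t :: "'x::comm_semiring_1"
  proof -
    have X: "chain k (star \<mu>) \<mu> (F (star \<mu>))" using chain[OF star[OF \<mu>]] star2[OF \<mu>] by simp
    have r: "row \<mu> = (\<mu>, star \<mu>, F \<mu>)" "row (star \<mu>) = (star \<mu>, \<mu>, F (star \<mu>))"
      by (simp_all add: row_def star2[OF \<mu>])
    have "Cat n (chain.C \<mu> (star \<mu>) (F \<mu>)) q t = Cat n (chain.C (star \<mu>) \<mu> (F (star \<mu>))) t q"
    proof -
      consider "mirror_rows k (row \<mu>) (row (star \<mu>))" | "mirror_rows k (row (star \<mu>)) (row \<mu>)"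
        using partner[OF \<mu>] by blast
      then show ?thesis
      proof cases
        case 1
        show ?thesis
          by (rule Cat_mirror[OF chain[OF \<mu>] X, of "k + 3"])
             (use 1 in \<open>auto simp: r mirror_rows_def mirror_ok_def list_all_iff\<close>)
      next
        case 2
        have "Cat n (chain.C (star \<mu>) \<mu> (F (star \<mu>))) t q = Cat n (chain.C \<mu> (star \<mu>) (F \<mu>)) q t"
          by (rule Cat_mirror[OF X chain[OF \<mu>], of "k + 3"])
             (use 2 in \<open>auto simp: r mirror_rows_def mirror_ok_def list_all_iff\<close>)
        then show ?thesis by simp
      qed
    qed
    then show ?thesis by (simp add: C_def star2[OF \<mu>])
  qed
  show ?thesis
  proof (intro exI[of _ C] exI[of _ star] conjI ballI allI impI)
    fix \<mu> assume \<mu>: "\<mu> \<in> Par k"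
    note ch = chain[OF \<mu>]
    show "star \<mu> \<in> Par k" "star (star \<mu>) = \<mu>" using \<mu> star star2 by auto
    show "psize \<mu> = k" using \<mu> by (simp add: Par_def)
    show "\<exists>c. C \<mu> = c ` {length (star \<mu>)..} \<and> (\<forall>i\<ge>length (star \<mu>). dinv (c i) = i)"
      unfolding C_def using chain.image_c[OF ch] chain.dinv_c[OF ch] by blast
    show "tail \<mu> \<subseteq> C \<mu>" using TI[of "row \<mu>"] C[OF \<mu>] by (auto simp: tail_eq_orbit row_def)
    show "Cat n (C \<mu>) var_q var_t = Cat n (C (star \<mu>)) var_t var_q" for n using Cat[OF \<mu>] .
    fix \<gamma> assume \<gamma>: "\<gamma> \<in> C \<mu>"
    then have "is_partition \<gamma> \<and> defc \<gamma> = int k" using chain.C_props[OF ch] by (simp add: C_def)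
    then show "is_partition \<gamma>" "defc \<gamma> = int (psize \<mu>)" using \<mu> by (auto simp: Par_def)
    show "\<delta> \<in> C \<mu>" if "nu \<gamma> = Some \<delta>" for \<delta>
      using \<gamma> orbit_closed that unfolding C[OF \<mu>] by blast
  qed (use disj cover in auto)
qed

section \<open>The tables\<close>

text \<open>In each table the first list holds the self-dual \<open>\<mu>\<close> and the second the pairs exchanged by
  the involution, each \<open>\<mu>\<close> with the initial partitions of its finite orbits in order of dinv. Other
  distributions exist; these are one solution of the covering problem.\<close>

definition table0 :: table where
  "table0 = (
    [([], [])],
    [])"

definition table1 :: table where
  "table1 = (
    [([1], [])],
    [])"

definition table2 :: table where
  "table2 = (
    [([2], [[1,1,1]]),
     ([1,1], [])],
    [])"

definition table3 :: table where
  "table3 = (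
    [([3], [[1,1,1,1], [2,2,2]])],
    [(([2,1], [[3,1,1,1]]),
      ([1,1,1], [[2,1,1,1]]))])"

definition table4 :: table where
  "table4 = (
    [([4], [[1,1,1,1,1], [2,2,2,1], [3,3,3,1]])],
    [(([3,1], [[2,2,1,1]]),
      ([2,2], [[2,1,1,1,1]])),
     (([2,1,1], [[3,2,1,1,1], [4,3,1,1,1]]),
      ([1,1,1,1], [[3,1,1,1,1], [4,2,1,1,1]]))])"

definition table5 :: table where
  "table5 = (
    [([5], [[1,1,1,1,1,1], [2,2,2,2], [3,3,3,2], [4,4,4,2,1]]),
     ([3,2], [[2,2,1,1,1], [3,3,1,1,1], [4,4,1,1,1]]),
     ([3,1,1], [[3,1,1,1,1,1], [4,2,2,1,1]]),
     ([2,1,1,1], [[3,2,1,1,1,1], [4,3,1,1,1,1], [5,3,2,1,1,1], [5,4,3,1,1,1]]),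
     ([1,1,1,1,1], [[4,2,1,1,1,1], [4,3,2,1,1,1], [5,4,2,1,1,1]])],
    [(([4,1], [[4,1,1,1,1], [3,3,2,2]]),
      ([2,2,1], [[2,1,1,1,1,1], [3,2,2,2]]))])"

definition table6 :: table where
  "table6 = (
    [([2,2,2], [[2,2,2,2,1]]),
     ([2,1,1,1,1], [[4,2,1,1,1,1,1], [4,3,2,1,1,1,1], [5,4,2,1,1,1,1], [5,4,3,2,1,1,1],
         [6,5,3,2,1,1,1], [6,5,4,3,1,1,1]]),
     ([1,1,1,1,1,1], [[4,3,1,1,1,1,1], [5,3,2,1,1,1,1], [5,4,3,1,1,1,1], [6,4,3,2,1,1,1],
         [6,5,4,2,1,1,1]])],
    [(([6], [[3,3,1,1,1,1], [3,3,3,2,1], [4,4,4,3,1], [5,5,5,3,2,1]]),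
      ([2,2,1,1], [[1,1,1,1,1,1,1], [3,2,2,1,1]])),
     (([5,1], [[2,2,2,1,1], [3,3,3,1,1], [4,4,3,3,1]]),
      ([3,3], [[2,1,1,1,1,1,1], [3,2,2,2,1]])),
     (([4,2], [[3,1,1,1,1,1,1], [4,2,2,2,1], [4,4,4,1,1]]),
      ([4,1,1], [[2,2,1,1,1,1], [3,3,2,1,1]])),
     (([3,2,1], [[3,2,1,1,1,1,1], [5,3,1,1,1,1], [5,3,3,1,1,1], [5,5,3,1,1,1]]),
      ([3,1,1,1], [[4,1,1,1,1,1], [4,2,2,1,1,1], [4,4,2,1,1,1], [5,4,2,2,1,1]]))])"

definition table7 :: table where
  "table7 = (
    [([7], [[1,1,1,1,1,1,1,1], [2,2,2,2,2], [3,3,3,3,1], [4,4,4,3,2], [5,5,5,4,2,1],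
         [6,6,6,4,3,2,1]]),
     ([5,2], [[2,2,1,1,1,1,1], [3,3,2,2,1], [5,5,5,3,1,1]]),
     ([4,1,1,1], [[3,2,1,1,1,1,1,1], [5,4,1,1,1,1], [5,3,3,2,1,1]])],
    [(([6,1], [[3,2,2,1,1,1], [3,3,3,3], [4,4,4,2,2], [5,5,4,4,2,1]]),
      ([3,3,1], [[2,1,1,1,1,1,1,1], [3,2,2,2,2], [4,3,3,3,1]])),
     (([5,1,1], [[3,3,2,1,1,1], [4,3,3,1,1,1], [4,4,3,2,2]]),
      ([2,2,2,1], [[3,1,1,1,1,1,1,1], [4,2,2,2,2], [5,5,2,1,1,1]])),
     (([4,3], [[5,1,1,1,1,1], [5,2,2,1,1,1], [4,4,2,2,2], [5,5,4,1,1,1]]),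
      ([3,2,2], [[2,2,2,1,1,1], [5,2,1,1,1,1], [4,3,2,2,2], [5,4,4,1,1,1]])),
     (([4,2,1], [[4,2,2,1,1,1,1], [4,4,3,1,1,1], [5,5,2,2,1,1]]),
      ([2,2,1,1,1], [[4,1,1,1,1,1,1], [4,4,1,1,1,1], [5,3,2,2,1,1]])),
     (([3,2,1,1], [[4,2,1,1,1,1,1,1], [4,4,2,1,1,1,1], [5,4,2,2,1,1,1], [5,5,3,2,1,1,1],
         [6,5,3,3,1,1,1], [6,6,4,3,1,1,1]]),
      ([3,1,1,1,1], [[3,3,1,1,1,1,1], [5,3,1,1,1,1,1], [5,3,3,1,1,1,1], [6,4,3,1,1,1,1],
         [6,4,4,2,1,1,1], [6,5,4,2,2,1,1]])),
     (([2,1,1,1,1,1], [[4,3,2,1,1,1,1,1], [5,4,2,1,1,1,1,1], [5,4,3,2,1,1,1,1], [6,5,3,2,1,1,1,1],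
         [6,5,4,3,1,1,1,1], [7,5,4,3,2,1,1,1], [7,6,5,3,2,1,1,1], [7,6,5,4,3,1,1,1]]),
      ([1,1,1,1,1,1,1], [[4,3,1,1,1,1,1,1], [5,3,2,1,1,1,1,1], [5,4,3,1,1,1,1,1],
         [6,4,3,2,1,1,1,1], [6,5,4,2,1,1,1,1], [6,5,4,3,2,1,1,1], [7,6,4,3,2,1,1,1],
         [7,6,5,4,2,1,1,1]]))])"

definition table8 :: table where
  "table8 = (
    [([5,2,1], [[4,1,1,1,1,1,1,1], [4,2,2,2,2,1], [5,3,3,3,1,1], [5,5,4,4,1,1]]),
     ([4,3,1], [[3,2,2,1,1,1,1], [5,2,2,2,1,1], [5,4,2,2,2,1], [5,5,5,2,1,1]]),
     ([4,1,1,1,1], [[4,2,1,1,1,1,1,1,1], [5,3,2,2,1,1,1], [5,5,3,1,1,1,1], [6,4,3,3,1,1,1],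
         [6,5,3,3,2,1,1]]),
     ([3,3,2], [[2,2,2,2,2,1], [3,3,3,3,2]]),
     ([3,2,2,1], [[3,3,2,1,1,1,1], [4,3,3,2,2]]),
     ([3,2,1,1,1], [[4,2,2,1,1,1,1,1], [4,4,2,1,1,1,1,1], [5,4,2,2,1,1,1,1], [5,5,3,2,1,1,1,1],
         [6,5,3,3,1,1,1,1], [7,5,4,3,1,1,1,1], [7,5,5,3,2,1,1,1], [7,6,5,3,3,1,1,1],
         [7,7,5,4,3,1,1,1]]),
     ([3,1,1,1,1,1], [[4,3,1,1,1,1,1,1,1], [5,3,3,1,1,1,1,1], [6,4,3,1,1,1,1,1],
         [6,4,4,2,1,1,1,1], [6,5,4,2,2,1,1,1], [6,6,4,3,2,1,1,1], [7,6,4,4,2,1,1,1],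
         [7,6,5,4,2,2,1,1]]),
     ([2,2,2,1,1], [[4,4,1,1,1,1,1], [4,4,3,1,1,1,1], [6,4,2,2,1,1,1], [5,5,4,2,1,1,1],
         [6,6,4,2,1,1,1]])],
    [(([8], [[5,1,1,1,1,1,1], [5,2,2,1,1,1,1], [5,3,2,2,2,1], [4,4,4,3,2,1], [5,5,5,4,3,1],
         [6,6,6,5,3,2,1], [7,7,7,5,4,3,2,1]]),
      ([4,2,2], [[1,1,1,1,1,1,1,1,1], [3,2,2,2,1,1], [4,4,2,2,1,1], [6,6,5,3,1,1,1]])),
     (([7,1], [[2,2,2,2,1,1], [3,3,3,2,2], [4,4,4,3,1,1], [5,5,5,3,3,1], [6,6,5,5,3,2,1]]),
      ([4,4], [[2,1,1,1,1,1,1,1,1], [3,2,2,2,2,1], [4,3,3,3,2]])),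
     (([6,2], [[3,2,1,1,1,1,1,1,1], [5,5,1,1,1,1], [4,4,3,3,2], [6,6,6,4,3,1,1]]),
      ([5,1,1,1], [[2,2,1,1,1,1,1,1], [3,3,2,2,2], [4,4,3,2,1,1]])),
     (([6,1,1], [[3,3,1,1,1,1,1,1], [4,3,3,1,1,1,1], [4,4,4,2,1,1], [5,5,4,3,3,1]]),
      ([4,2,1,1], [[3,1,1,1,1,1,1,1,1], [4,3,2,2,1,1], [6,6,4,2,2,1,1]])),
     (([5,3], [[3,3,3,1,1,1], [4,3,2,2,2,1], [5,5,2,2,2,1], [5,5,5,2,2,1]]),
      ([2,2,2,2], [[2,2,2,1,1,1,1], [4,2,2,2,1,1], [4,4,4,1,1,1]])),
     (([3,3,1,1], [[5,3,1,1,1,1,1,1], [5,3,3,2,1,1,1], [5,4,4,2,1,1,1], [6,4,4,3,1,1,1],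
         [6,5,5,3,1,1,1]]),
      ([2,2,1,1,1,1], [[5,2,1,1,1,1,1], [5,4,1,1,1,1,1], [6,4,2,1,1,1,1], [6,5,3,1,1,1,1],
         [6,5,3,2,2,1,1]])),
     (([2,1,1,1,1,1,1], [[5,3,2,1,1,1,1,1,1], [5,4,3,1,1,1,1,1,1], [6,4,3,2,1,1,1,1,1],
         [6,5,4,2,1,1,1,1,1], [6,5,4,3,2,1,1,1,1], [7,6,4,3,2,1,1,1,1], [7,6,5,4,2,1,1,1,1],
         [7,6,5,4,3,2,1,1,1], [8,7,5,4,3,2,1,1,1], [8,7,6,5,3,2,1,1,1], [8,7,6,5,4,3,1,1,1]]),
      ([1,1,1,1,1,1,1,1], [[4,3,2,1,1,1,1,1,1], [5,4,2,1,1,1,1,1,1], [5,4,3,2,1,1,1,1,1],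
         [6,5,3,2,1,1,1,1,1], [6,5,4,3,1,1,1,1,1], [7,5,4,3,2,1,1,1,1], [7,6,5,3,2,1,1,1,1],
         [7,6,5,4,3,1,1,1,1], [8,6,5,4,3,2,1,1,1], [8,7,6,4,3,2,1,1,1], [8,7,6,5,4,2,1,1,1]]))])"

definition table9 :: table where
  "table9 = (
    [([9], [[1,1,1,1,1,1,1,1,1,1], [2,2,2,2,2,2], [3,3,3,3,2,1], [5,4,4,4,1,1], [5,5,5,4,3,2],
         [6,6,6,5,4,2,1], [7,7,7,6,4,3,2,1], [8,8,8,6,5,4,3,2,1]]),
     ([7,1,1], [[3,1,1,1,1,1,1,1,1,1], [4,2,2,2,2,2], [4,4,4,4,1], [5,5,5,3,2,2],
         [6,6,5,4,4,2,1]]),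
     ([6,3], [[2,2,2,1,1,1,1,1], [3,3,3,2,1,1], [5,3,3,3,2,1], [5,5,5,4,1,1], [6,6,6,4,2,2,1]]),
     ([5,3,1], [[5,1,1,1,1,1,1,1], [4,3,2,2,1,1,1], [6,3,3,1,1,1,1], [5,4,3,2,2,2],
         [6,6,3,3,1,1,1], [6,6,5,2,2,1,1]]),
     ([3,3,2,1], [[3,3,3,1,1,1,1], [4,4,2,2,2,1], [5,5,5,1,1,1], [5,5,3,3,3,1]]),
     ([3,2,2,2], [[4,2,2,2,1,1,1], [4,3,3,3,1,1], [4,4,4,4,2,1]]),
     ([3,2,1,1,1,1], [[5,3,1,1,1,1,1,1,1], [5,3,3,1,1,1,1,1,1], [6,4,3,1,1,1,1,1,1],
         [6,4,4,2,1,1,1,1,1], [6,5,4,2,2,1,1,1,1], [6,6,4,3,2,1,1,1,1], [7,6,4,4,2,1,1,1,1],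
         [7,6,5,4,2,2,1,1,1], [7,7,5,4,3,2,1,1,1], [8,7,5,5,3,2,1,1,1], [8,7,6,5,3,3,1,1,1],
         [8,8,6,5,4,3,1,1,1]]),
     ([3,1,1,1,1,1,1], [[4,3,2,1,1,1,1,1,1,1], [5,4,2,2,1,1,1,1,1], [5,5,3,2,1,1,1,1,1],
         [6,5,3,3,1,1,1,1,1], [7,5,4,3,1,1,1,1,1], [7,5,5,3,2,1,1,1,1], [7,6,5,3,3,1,1,1,1],
         [8,6,5,4,3,1,1,1,1], [8,6,6,4,3,2,1,1,1], [8,7,6,4,4,2,1,1,1], [8,7,6,5,4,2,2,1,1]]),
     ([2,1,1,1,1,1,1,1], [[5,3,2,1,1,1,1,1,1,1], [5,4,3,1,1,1,1,1,1,1], [6,4,3,2,1,1,1,1,1,1],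
         [6,5,4,2,1,1,1,1,1,1], [6,5,4,3,2,1,1,1,1,1], [7,6,4,3,2,1,1,1,1,1],
         [7,6,5,4,2,1,1,1,1,1], [7,6,5,4,3,2,1,1,1,1], [8,7,5,4,3,2,1,1,1,1],
         [8,7,6,5,3,2,1,1,1,1], [8,7,6,5,4,3,1,1,1,1], [9,7,6,5,4,3,2,1,1,1],
         [9,8,7,5,4,3,2,1,1,1], [9,8,7,6,5,3,2,1,1,1], [9,8,7,6,5,4,3,1,1,1]]),
     ([1,1,1,1,1,1,1,1,1], [[5,4,2,1,1,1,1,1,1,1], [5,4,3,2,1,1,1,1,1,1], [6,5,3,2,1,1,1,1,1,1],
         [6,5,4,3,1,1,1,1,1,1], [7,5,4,3,2,1,1,1,1,1], [7,6,5,3,2,1,1,1,1,1],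
         [7,6,5,4,3,1,1,1,1,1], [8,6,5,4,3,2,1,1,1,1], [8,7,6,4,3,2,1,1,1,1],
         [8,7,6,5,4,2,1,1,1,1], [8,7,6,5,4,3,2,1,1,1], [9,8,6,5,4,3,2,1,1,1],
         [9,8,7,6,4,3,2,1,1,1], [9,8,7,6,5,4,2,1,1,1]])],
    [(([8,1], [[3,3,2,1,1,1,1,1], [4,4,2,2,1,1,1], [5,4,2,2,2,2], [5,5,4,2,2,2], [5,5,5,4,2,2],
         [6,6,6,4,4,2,1], [7,7,6,6,4,3,2,1]]),
      ([4,2,2,1], [[2,1,1,1,1,1,1,1,1,1], [3,2,2,2,2,2], [5,3,2,2,2,2], [5,5,3,2,2,2],
         [6,5,5,2,2,1,1]])),
     (([7,2], [[6,1,1,1,1,1,1], [5,2,2,2,2,1], [4,4,4,2,2,1], [5,5,4,4,3,1], [7,7,7,5,4,3,1,1]]),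
      ([4,3,2], [[2,2,1,1,1,1,1,1,1], [3,3,2,2,2,1], [4,3,3,3,2,1], [5,4,4,4,2,1]])),
     (([6,2,1], [[4,4,1,1,1,1,1,1], [4,4,3,3,1,1], [6,6,5,5,3,1,1]]),
      ([3,3,1,1,1], [[4,1,1,1,1,1,1,1,1], [4,3,3,2,1,1]])),
     (([6,1,1,1], [[3,3,2,2,1,1], [5,5,4,3,2,2]]),
      ([3,3,3], [[3,2,1,1,1,1,1,1,1,1], [4,3,2,2,2,2]])),
     (([5,4], [[4,2,1,1,1,1,1,1,1,1], [4,4,3,2,1,1,1], [6,4,4,1,1,1,1], [5,5,4,3,1,1,1],
         [6,5,4,4,1,1,1], [6,6,5,4,1,1,1]]),
      ([5,1,1,1,1], [[2,2,2,2,1,1,1], [6,2,1,1,1,1,1], [6,3,2,1,1,1,1], [5,4,4,1,1,1,1],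
         [6,5,4,1,1,1,1], [6,4,4,3,2,1,1]])),
     (([5,2,2], [[6,3,1,1,1,1,1], [5,3,3,2,2,1], [6,6,6,4,2,1,1]]),
      ([2,2,2,2,1], [[3,2,2,1,1,1,1,1], [3,3,3,3,1,1], [4,4,4,4,2]])),
     (([5,2,1,1], [[3,2,2,2,1,1,1], [5,2,2,2,1,1,1], [5,5,2,1,1,1,1], [6,5,2,2,1,1,1],
         [6,6,3,2,1,1,1], [6,6,3,3,2,1,1]]),
      ([4,4,1], [[3,3,1,1,1,1,1,1,1], [6,4,1,1,1,1,1], [5,5,2,2,1,1,1], [5,5,3,3,1,1,1],
         [6,5,5,2,1,1,1], [6,6,4,4,1,1,1]])),
     (([4,3,1,1], [[5,2,2,1,1,1,1,1], [4,4,3,1,1,1,1,1], [5,4,3,3,1,1,1], [6,4,4,2,2,1,1],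
         [7,7,6,4,3,1,1,1]]),
      ([3,2,2,1,1], [[5,2,1,1,1,1,1,1], [4,3,3,1,1,1,1,1], [6,3,3,2,1,1,1], [6,4,3,2,2,1,1],
         [7,6,6,4,3,1,1,1]])),
     (([4,2,1,1,1], [[5,4,1,1,1,1,1,1], [5,3,3,2,1,1,1,1], [5,4,4,2,1,1,1,1], [6,5,3,2,2,1,1,1],
         [7,5,4,2,2,1,1,1], [6,6,5,3,2,1,1,1], [7,6,4,4,3,1,1,1], [7,7,5,4,2,2,1,1]]),
      ([2,2,2,1,1,1], [[4,2,2,1,1,1,1,1,1], [5,3,2,2,1,1,1,1], [6,4,2,2,1,1,1,1],
         [5,5,4,2,1,1,1,1], [6,5,3,3,2,1,1,1], [6,5,5,3,2,1,1,1], [7,6,4,3,3,1,1,1],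
         [7,7,5,4,2,1,1,1]])),
     (([4,1,1,1,1,1], [[4,4,2,1,1,1,1,1,1], [5,5,3,1,1,1,1,1], [6,4,3,3,1,1,1,1],
         [7,5,4,2,1,1,1,1], [7,6,4,3,1,1,1,1], [7,5,5,4,2,1,1,1], [7,6,5,3,3,2,1,1]]),
      ([2,2,1,1,1,1,1], [[4,3,1,1,1,1,1,1,1,1], [6,4,2,1,1,1,1,1], [6,5,3,1,1,1,1,1],
         [6,4,4,3,1,1,1,1], [6,6,4,3,1,1,1,1], [7,5,4,4,2,1,1,1], [7,6,5,3,2,2,1,1]]))])"

definition table10 :: table where
  "table10 = (
    [([7,1,1,1], [[3,2,1,1,1,1,1,1,1,1,1], [4,3,2,2,2,2,1], [5,4,3,2,2,2,1], [5,5,5,3,2,1,1],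
         [6,6,5,4,3,3,1]]),
     ([6,4], [[2,2,2,2,1,1,1,1], [3,3,3,2,1,1,1], [6,5,1,1,1,1,1], [5,5,4,1,1,1,1],
         [5,5,5,2,1,1,1], [6,6,5,2,1,1,1], [6,6,5,2,2,2,1], [6,6,6,3,3,2,1]]),
     ([5,2,2,1], [[3,3,2,1,1,1,1,1,1], [5,3,2,2,2,1,1], [6,5,2,2,2,1,1], [6,5,3,3,3,1,1],
         [6,6,5,5,2,1,1]]),
     ([5,1,1,1,1,1], [[4,3,1,1,1,1,1,1,1,1,1], [5,5,2,2,1,1,1,1], [5,5,3,3,1,1,1,1],
         [6,6,4,2,1,1,1,1], [6,5,4,4,2,1,1,1], [6,6,5,4,2,1,1,1], [7,6,4,4,3,2,1,1]]),
     ([4,2,2,1,1], [[4,4,1,1,1,1,1,1,1], [4,4,3,1,1,1,1,1,1], [6,5,2,2,1,1,1,1],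
         [5,5,4,3,1,1,1,1], [6,5,5,3,1,1,1,1], [7,5,4,3,3,1,1,1], [7,6,4,4,2,2,1,1],
         [8,8,7,5,4,3,1,1,1]]),
     ([3,3,3,1], [[6,2,2,1,1,1,1], [4,4,2,2,2,2], [6,6,3,1,1,1,1], [5,5,5,2,2,2]]),
     ([2,1,1,1,1,1,1,1,1], [[5,4,2,1,1,1,1,1,1,1,1], [5,4,3,2,1,1,1,1,1,1,1],
         [6,5,3,2,1,1,1,1,1,1,1], [6,5,4,3,1,1,1,1,1,1,1], [7,5,4,3,2,1,1,1,1,1,1],
         [7,6,5,3,2,1,1,1,1,1,1], [7,6,5,4,3,1,1,1,1,1,1], [8,6,5,4,3,2,1,1,1,1,1],
         [8,7,6,4,3,2,1,1,1,1,1], [8,7,6,5,4,2,1,1,1,1,1], [8,7,6,5,4,3,2,1,1,1,1],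
         [9,8,6,5,4,3,2,1,1,1,1], [9,8,7,6,4,3,2,1,1,1,1], [9,8,7,6,5,4,2,1,1,1,1],
         [9,8,7,6,5,4,3,2,1,1,1], [10,9,7,6,5,4,3,2,1,1,1], [10,9,8,7,5,4,3,2,1,1,1],
         [10,9,8,7,6,5,3,2,1,1,1], [10,9,8,7,6,5,4,3,1,1,1]]),
     ([1,1,1,1,1,1,1,1,1,1], [[5,4,3,1,1,1,1,1,1,1,1], [6,4,3,2,1,1,1,1,1,1,1],
         [6,5,4,2,1,1,1,1,1,1,1], [6,5,4,3,2,1,1,1,1,1,1], [7,6,4,3,2,1,1,1,1,1,1],
         [7,6,5,4,2,1,1,1,1,1,1], [7,6,5,4,3,2,1,1,1,1,1], [8,7,5,4,3,2,1,1,1,1,1],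
         [8,7,6,5,3,2,1,1,1,1,1], [8,7,6,5,4,3,1,1,1,1,1], [9,7,6,5,4,3,2,1,1,1,1],
         [9,8,7,5,4,3,2,1,1,1,1], [9,8,7,6,5,3,2,1,1,1,1], [9,8,7,6,5,4,3,1,1,1,1],
         [10,8,7,6,5,4,3,2,1,1,1], [10,9,8,6,5,4,3,2,1,1,1], [10,9,8,7,6,4,3,2,1,1,1],
         [10,9,8,7,6,5,4,2,1,1,1]])],
    [(([10], [[2,2,2,1,1,1,1,1,1], [3,3,3,2,2,1], [4,4,4,4,1,1], [6,5,5,4,1,1,1], [5,5,5,4,3,2,1],
         [6,6,6,5,4,3,1], [7,7,7,6,5,3,2,1], [8,8,8,7,5,4,3,2,1], [9,9,9,7,6,5,4,3,2,1]]),
      ([7,3], [[1,1,1,1,1,1,1,1,1,1,1], [3,3,2,2,1,1,1], [5,5,1,1,1,1,1], [4,4,3,3,2,1],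
         [6,6,6,5,3,1,1], [7,7,7,5,4,2,2,1]])),
     (([9,1], [[4,2,2,1,1,1,1,1,1,1], [5,5,2,1,1,1,1,1], [5,4,4,3,1,1,1], [6,5,3,2,2,2,1],
         [5,5,5,4,3,1,1], [6,6,6,5,3,3,1], [7,7,7,5,5,3,2,1], [8,8,7,7,5,4,3,2,1]]),
      ([5,2,1,1,1], [[2,1,1,1,1,1,1,1,1,1,1], [3,2,2,2,2,2,1], [4,4,4,2,1,1,1], [5,5,3,2,2,1,1],
         [7,7,5,3,3,2,1,1]])),
     (([8,2], [[4,2,2,2,2,1,1], [4,4,3,3,3], [5,5,5,3,1,1,1], [5,5,5,3,3,2], [6,6,5,5,4,2,1],
         [8,8,8,6,5,4,3,1,1]]),
      ([3,3,2,2], [[2,2,1,1,1,1,1,1,1,1], [3,3,2,2,2,2], [6,5,2,1,1,1,1], [4,4,4,3,3,1]])),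
     (([8,1,1], [[6,1,1,1,1,1,1,1], [3,3,3,3,3], [5,4,3,3,3,1], [5,5,5,4,2,1,1], [6,6,6,4,3,3,1],
         [7,7,6,5,5,3,2,1]]),
      ([5,3,2], [[3,1,1,1,1,1,1,1,1,1,1], [4,3,3,2,1,1,1], [4,3,3,3,3,1], [5,4,4,4,3,1],
         [6,6,6,3,3,1,1]])),
     (([7,2,1], [[5,2,2,2,1,1,1,1], [5,3,3,3,1,1,1], [5,4,4,2,2,2], [5,5,4,4,2,2],
         [7,7,6,6,4,3,1,1]]),
      ([3,2,2,2,1], [[4,1,1,1,1,1,1,1,1,1], [5,2,2,2,2,2], [5,5,2,2,2,2], [6,6,3,2,2,1,1]])),
     (([6,3,1], [[3,2,2,2,2,1,1], [4,4,3,2,2,1], [7,7,7,5,4,2,1,1]]),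
      ([4,3,3], [[5,1,1,1,1,1,1,1,1], [4,3,3,2,2,1]])),
     (([6,2,2], [[4,3,3,1,1,1,1,1,1], [6,4,2,2,2,1,1], [6,4,4,4,1,1,1], [6,6,3,3,3,1,1],
         [6,6,5,5,2,2,1]]),
      ([3,3,1,1,1,1], [[3,2,2,1,1,1,1,1,1], [6,2,2,2,1,1,1], [5,4,2,2,2,1,1], [6,4,3,3,2,1,1]])),
     (([6,2,1,1], [[4,2,2,2,1,1,1,1], [3,3,3,3,3,1], [6,6,4,1,1,1,1], [6,4,4,4,2,1,1],
         [6,6,5,4,4,1,1]]),
      ([4,3,2,1], [[3,3,1,1,1,1,1,1,1,1], [4,4,4,1,1,1,1], [6,3,3,3,1,1,1], [4,4,4,4,3,1],
         [6,6,6,3,2,1,1]])),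
     (([6,1,1,1,1], [[5,2,1,1,1,1,1,1,1], [6,4,1,1,1,1,1,1], [5,4,2,2,2,2,1], [5,5,4,3,2,1,1]]),
      ([5,3,1,1], [[4,2,1,1,1,1,1,1,1,1,1], [5,3,2,2,2,2,1], [5,5,4,2,2,1,1], [7,7,6,4,2,2,1,1]])),
     (([5,5], [[2,2,2,2,2,2,1], [6,3,2,2,1,1,1], [4,4,4,3,3], [6,6,4,2,2,2,1]]),
      ([4,4,2], [[2,2,2,2,2,1,1], [4,3,2,2,2,1,1], [5,3,3,3,3,1], [6,5,4,2,2,2,1]])),
     (([5,4,1], [[5,2,2,1,1,1,1,1,1], [4,4,3,2,1,1,1,1], [6,4,4,1,1,1,1,1], [6,4,4,2,2,1,1,1],
         [7,5,3,3,2,1,1,1], [7,6,5,3,1,1,1,1], [7,7,5,3,2,1,1,1], [7,6,5,5,3,1,1,1],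
         [7,7,6,5,3,1,1,1]]),
      ([4,3,1,1,1], [[3,2,2,2,1,1,1,1], [4,3,2,2,1,1,1,1], [6,3,3,1,1,1,1,1], [5,4,3,3,1,1,1,1],
         [7,5,3,2,1,1,1,1], [6,6,4,2,2,1,1,1], [6,6,4,4,2,1,1,1], [7,5,5,4,3,1,1,1],
         [7,6,6,4,2,2,1,1]])),
     (([4,4,1,1], [[6,3,1,1,1,1,1,1], [5,3,3,2,2,2], [5,4,4,3,3,1]]),
      ([3,3,2,1,1], [[6,2,1,1,1,1,1,1], [4,3,3,3,3], [5,5,3,3,2,2]])),
     (([4,2,2,2], [[5,3,1,1,1,1,1,1,1,1], [5,3,3,2,1,1,1,1,1], [6,4,3,2,2,1,1,1],
         [6,4,4,3,2,1,1,1], [7,5,5,3,1,1,1,1], [7,5,5,3,3,1,1,1], [7,7,5,3,3,1,1,1],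
         [7,7,5,5,3,1,1,1]]),
      ([4,2,1,1,1,1], [[3,3,3,1,1,1,1,1], [6,3,2,1,1,1,1,1], [5,4,4,1,1,1,1,1], [6,5,4,1,1,1,1,1],
         [7,5,3,3,1,1,1,1], [7,6,4,2,2,1,1,1], [7,6,4,3,2,2,1,1], [8,8,6,5,4,2,2,1,1]])),
     (([4,1,1,1,1,1,1], [[5,4,1,1,1,1,1,1,1], [6,4,2,1,1,1,1,1,1], [5,4,4,2,1,1,1,1,1],
         [6,5,3,2,2,1,1,1,1], [6,6,4,3,1,1,1,1,1], [7,5,4,4,2,1,1,1,1], [7,6,5,3,2,2,1,1,1],
         [8,6,5,4,2,2,1,1,1], [7,7,6,4,3,2,1,1,1], [8,7,6,4,3,3,1,1,1], [8,7,6,5,3,3,2,1,1]]),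
      ([3,2,2,1,1,1], [[4,3,2,1,1,1,1,1,1,1,1], [6,4,2,2,1,1,1,1,1], [6,4,3,3,1,1,1,1,1],
         [6,5,3,3,2,1,1,1,1], [6,5,5,3,2,1,1,1,1], [7,5,5,4,2,1,1,1,1], [8,6,5,4,2,1,1,1,1],
         [8,7,5,4,3,1,1,1,1], [8,7,5,4,4,2,1,1,1], [8,7,6,4,4,3,1,1,1], [8,7,7,5,4,3,1,1,1]])),
     (([3,2,1,1,1,1,1], [[5,3,2,1,1,1,1,1,1,1,1], [6,4,3,1,1,1,1,1,1,1], [6,4,4,2,1,1,1,1,1,1],
         [6,5,4,2,2,1,1,1,1,1], [6,6,4,3,2,1,1,1,1,1], [7,6,4,4,2,1,1,1,1,1],
         [7,6,5,4,2,2,1,1,1,1], [7,7,5,4,3,2,1,1,1,1], [8,7,5,5,3,2,1,1,1,1],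
         [8,7,6,5,3,3,1,1,1,1], [9,7,6,5,4,3,1,1,1,1], [9,7,7,5,4,3,2,1,1,1],
         [9,8,7,5,5,3,2,1,1,1], [9,8,7,6,5,3,3,1,1,1], [9,9,7,6,5,4,3,1,1,1]]),
      ([3,1,1,1,1,1,1,1], [[4,4,2,1,1,1,1,1,1,1], [5,4,2,2,1,1,1,1,1,1], [5,5,3,2,1,1,1,1,1,1],
         [6,5,3,3,1,1,1,1,1,1], [7,5,4,3,1,1,1,1,1,1], [7,5,5,3,2,1,1,1,1,1],
         [7,6,5,3,3,1,1,1,1,1], [8,6,5,4,3,1,1,1,1,1], [8,6,6,4,3,2,1,1,1,1],
         [8,7,6,4,4,2,1,1,1,1], [8,7,6,5,4,2,2,1,1,1], [8,8,6,5,4,3,2,1,1,1],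
         [9,8,6,6,4,3,2,1,1,1], [9,8,7,6,4,4,2,1,1,1], [9,8,7,6,5,4,2,2,1,1]])),
     (([2,2,2,2,2], [[4,4,2,2,1,1,1,1], [6,3,3,2,1,1,1,1], [6,4,3,2,2,2,1]]),
      ([2,2,2,2,1,1], [[4,2,2,2,2,2,1], [5,4,3,2,2,1,1], [7,6,6,4,2,1,1,1]])),
     (([2,2,2,1,1,1,1], [[5,3,3,1,1,1,1,1,1,1], [6,5,3,1,1,1,1,1,1], [6,4,4,3,1,1,1,1,1],
         [7,5,4,2,2,1,1,1,1], [6,6,5,3,2,1,1,1,1], [7,6,4,4,3,1,1,1,1], [7,7,5,4,3,1,1,1,1],
         [8,6,5,5,3,2,1,1,1], [8,7,5,5,4,2,1,1,1], [8,8,6,5,4,2,1,1,1]]),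
      ([2,2,1,1,1,1,1,1], [[5,3,2,2,1,1,1,1,1], [5,5,3,1,1,1,1,1,1], [5,5,4,2,1,1,1,1,1],
         [7,5,4,2,1,1,1,1,1], [7,6,4,3,1,1,1,1,1], [7,6,4,3,3,1,1,1,1], [7,6,5,3,3,2,1,1,1],
         [7,6,6,4,3,2,1,1,1], [8,6,6,5,3,2,1,1,1], [8,7,6,5,3,2,2,1,1]]))])"

definition table11 :: table where
  "table11 = (
    [([11], [[1,1,1,1,1,1,1,1,1,1,1,1], [2,2,2,2,2,2,2], [4,3,3,3,2,2], [4,4,4,4,3,2],
         [6,5,5,5,3,1,1], [6,6,6,5,4,3,2], [7,7,7,6,5,4,2,1], [8,8,8,7,6,4,3,2,1],
         [9,9,9,8,6,5,4,3,2,1], [10,10,10,8,7,6,5,4,3,2,1]]),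
     ([9,2], [[2,2,1,1,1,1,1,1,1,1,1], [3,3,2,2,2,2,1], [5,3,3,2,2,2,1], [6,4,4,2,2,2,1],
         [5,5,5,4,2,2,1], [6,6,6,4,4,3,1], [7,7,6,6,5,3,2,1], [9,9,9,7,6,5,4,3,1,1]]),
     ([9,1,1], [[3,1,1,1,1,1,1,1,1,1,1,1], [4,2,2,2,2,2,2], [6,4,2,2,2,1,1,1], [7,5,4,1,1,1,1,1],
         [6,5,4,2,2,2,2], [7,5,4,4,3,1,1,1], [7,7,4,4,3,1,1,1], [6,6,6,5,3,2,2],
         [7,7,7,5,4,4,2,1], [8,8,7,6,6,4,3,2,1]]),
     ([6,3,2], [[3,2,2,2,1,1,1,1,1], [4,4,2,2,2,1,1], [5,3,3,3,3,2], [6,6,3,3,2,2,1],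
         [7,7,7,5,3,3,1,1]]),
     ([6,3,1,1], [[3,3,2,1,1,1,1,1,1,1], [5,3,2,2,2,1,1,1], [5,4,3,3,2,2], [7,7,6,3,3,2,1,1]]),
     ([4,4,2,1], [[4,2,2,2,2,1,1,1], [6,3,2,2,1,1,1,1], [4,4,4,3,2,2], [5,5,5,5,3,1],
         [7,7,5,4,4,1,1,1]]),
     ([4,4,1,1,1], [[5,2,2,2,1,1,1,1,1], [5,5,2,1,1,1,1,1,1], [6,4,4,1,1,1,1,1,1],
         [6,4,4,2,2,1,1,1,1], [6,6,4,2,2,1,1,1,1], [7,5,4,3,3,1,1,1,1], [8,6,5,3,2,1,1,1,1],
         [8,6,5,3,3,2,1,1,1], [8,6,5,4,4,2,1,1,1], [8,7,5,5,3,3,1,1,1], [8,7,7,5,4,2,1,1,1],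
         [8,8,6,6,4,3,1,1,1]]),
     ([4,3,1,1,1,1], [[4,3,3,1,1,1,1,1,1,1], [5,3,3,2,1,1,1,1,1,1], [6,5,4,1,1,1,1,1,1],
         [6,6,4,2,1,1,1,1,1], [7,6,4,2,2,1,1,1,1], [7,6,4,3,2,2,1,1,1], [8,6,5,3,3,1,1,1,1],
         [8,7,5,4,2,2,1,1,1], [8,7,5,4,3,3,1,1,1], [8,7,6,4,4,2,2,1,1], [9,9,8,6,5,4,3,1,1,1]]),
     ([4,2,2,1,1,1], [[5,4,1,1,1,1,1,1,1,1], [5,5,2,2,1,1,1,1,1], [5,5,3,3,1,1,1,1,1],
         [6,4,4,3,2,1,1,1,1], [6,5,4,4,2,1,1,1,1], [6,6,5,4,2,1,1,1,1], [7,6,4,4,3,2,1,1,1],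
         [7,6,5,5,3,2,1,1,1], [7,7,6,5,3,2,1,1,1], [8,8,6,5,3,2,1,1,1], [8,7,7,5,4,2,2,1,1]]),
     ([3,3,2,1,1,1], [[6,3,2,1,1,1,1,1,1], [5,4,4,1,1,1,1,1,1], [6,4,3,2,2,1,1,1,1],
         [7,5,3,3,1,1,1,1,1], [7,5,5,3,1,1,1,1,1], [7,5,5,3,3,1,1,1,1], [7,7,5,4,2,1,1,1,1],
         [8,6,6,4,3,1,1,1,1], [8,6,6,4,4,2,1,1,1], [8,7,5,5,4,3,1,1,1], [8,7,6,6,4,3,1,1,1]]),
     ([3,2,2,1,1,1,1], [[4,4,3,1,1,1,1,1,1,1], [5,5,3,1,1,1,1,1,1,1], [6,4,3,3,1,1,1,1,1,1],
         [6,5,3,3,2,1,1,1,1,1], [7,6,4,3,1,1,1,1,1,1], [7,5,5,4,2,1,1,1,1,1],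
         [8,6,5,4,2,1,1,1,1,1], [7,6,6,4,3,2,1,1,1,1], [8,7,5,4,4,2,1,1,1,1],
         [8,7,6,5,3,2,2,1,1,1], [9,7,6,5,4,2,2,1,1,1], [8,8,7,5,4,3,2,1,1,1],
         [9,8,6,6,5,3,2,1,1,1], [9,8,7,6,4,4,3,1,1,1], [9,8,8,6,5,4,3,1,1,1]]),
     ([2,2,1,1,1,1,1,1,1], [[5,4,2,2,1,1,1,1,1,1,1], [5,5,4,2,1,1,1,1,1,1], [7,5,4,2,1,1,1,1,1,1],
         [6,5,5,3,2,1,1,1,1,1], [7,6,4,3,3,1,1,1,1,1], [7,6,5,3,3,2,1,1,1,1],
         [8,7,5,4,3,1,1,1,1,1], [8,6,6,5,3,2,1,1,1,1], [8,7,6,4,4,3,1,1,1,1],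
         [8,8,6,5,4,3,1,1,1,1], [9,7,6,6,4,3,2,1,1,1], [9,8,7,5,4,4,2,1,1,1],
         [9,8,7,6,5,3,2,2,1,1]])],
    [(([10,1], [[3,2,2,1,1,1,1,1,1,1], [3,3,3,3,2,2], [5,4,3,3,3,2], [6,6,6,3,1,1,1],
         [6,6,4,4,4,1,1], [6,6,6,5,4,2,2], [7,7,7,6,4,4,2,1], [8,8,8,6,6,4,3,2,1],
         [9,9,8,8,6,5,4,3,2,1]]),
      ([7,2,2], [[2,1,1,1,1,1,1,1,1,1,1,1], [3,2,2,2,2,2,2], [5,3,3,3,2,2], [5,5,4,3,3,2],
         [8,8,8,6,5,4,2,1,1]])),
     (([8,3], [[6,2,2,1,1,1,1,1], [3,3,3,3,3,2], [6,6,5,1,1,1,1], [5,5,4,4,3,2],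
         [7,7,7,6,4,3,1,1], [8,8,8,6,5,4,2,2,1]]),
      ([4,3,3,1], [[2,2,2,1,1,1,1,1,1,1], [3,3,3,2,2,2], [5,5,2,2,2,1,1], [5,5,3,3,3,2],
         [6,6,6,4,1,1,1], [6,6,4,4,4,2,1]])),
     (([8,2,1], [[2,2,2,2,2,1,1,1], [3,3,3,2,1,1,1,1], [4,4,3,2,2,2], [5,5,3,2,2,2,1],
         [5,5,5,3,3,1,1], [6,6,5,5,3,3,1], [8,8,7,7,5,4,3,1,1]]),
      ([6,5], [[4,1,1,1,1,1,1,1,1,1,1], [5,2,2,2,2,2,1], [6,6,2,2,1,1,1], [5,4,4,4,2,2],
         [5,5,5,5,3,2,1], [7,7,6,5,4,1,1,1]])),
     (([8,1,1,1], [[7,3,2,1,1,1,1,1], [5,5,4,1,1,1,1,1], [6,4,3,3,2,1,1,1], [6,6,3,3,2,1,1,1],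
         [6,5,5,4,2,1,1,1], [7,6,6,3,2,1,1,1], [6,6,6,4,3,2,2], [7,7,6,5,4,4,2,1]]),
      ([2,2,2,2,2,1], [[3,2,1,1,1,1,1,1,1,1,1,1], [4,3,2,2,2,2,2], [7,5,3,1,1,1,1,1],
         [7,4,4,3,1,1,1,1], [6,5,4,3,3,1,1,1], [7,6,5,4,1,1,1,1], [7,6,6,3,3,1,1,1]])),
     (([7,4], [[4,3,2,2,1,1,1,1,1], [7,4,2,1,1,1,1,1], [6,5,5,1,1,1,1], [5,5,5,4,1,1,1],
         [6,6,3,3,3,2,1], [6,6,6,5,2,2,1], [7,7,7,5,3,3,2,1]]),
      ([4,2,2,2,1], [[2,2,2,2,1,1,1,1,1], [3,3,3,3,1,1,1], [6,6,1,1,1,1,1], [6,3,3,3,2,1,1],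
         [5,5,5,5,2,1], [7,6,5,5,2,2,1,1]])),
     (([7,3,1], [[3,3,2,2,1,1,1,1], [4,3,3,2,1,1,1,1], [4,4,4,2,1,1,1,1], [6,6,2,2,2,1,1],
         [6,4,4,4,3,1,1], [6,6,6,4,4,1,1], [7,7,6,6,4,2,2,1]]),
      ([5,3,3], [[5,1,1,1,1,1,1,1,1,1], [6,2,2,2,2,1,1], [5,4,4,2,2,1,1], [7,6,5,4,4,1,1,1],
         [7,7,6,4,4,1,1,1]])),
     (([7,2,1,1], [[4,3,2,2,2,1,1,1], [4,3,3,3,3,2], [5,5,4,4,2,1,1], [7,7,6,5,5,3,1,1]]),
      ([3,3,3,1,1], [[3,3,1,1,1,1,1,1,1,1,1], [4,4,2,2,2,2,1], [4,4,4,4,2,2], [6,5,5,5,2,1,1]])),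
     (([7,1,1,1,1], [[4,2,2,1,1,1,1,1,1,1,1], [5,3,3,3,1,1,1,1], [6,5,2,2,2,1,1,1],
         [6,6,3,3,1,1,1,1], [6,6,5,3,1,1,1,1], [7,7,4,3,2,1,1,1], [6,6,5,4,3,2,2]]),
      ([6,2,1,1,1], [[4,2,1,1,1,1,1,1,1,1,1,1], [5,3,2,2,2,2,2], [6,6,3,2,1,1,1,1],
         [6,5,4,4,1,1,1,1], [7,6,4,4,1,1,1,1], [7,7,4,4,2,1,1,1], [7,7,4,4,3,2,1,1]])),
     (([6,4,1], [[5,2,1,1,1,1,1,1,1,1], [4,4,3,3,1,1,1], [5,5,5,1,1,1,1], [5,5,5,2,2,1,1],
         [6,6,5,3,3,3,1], [7,7,6,5,2,2,1,1]]),
      ([6,2,2,1], [[6,1,1,1,1,1,1,1,1], [6,2,2,2,1,1,1,1], [6,6,2,1,1,1,1], [5,4,4,4,1,1,1],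
         [6,4,4,3,3,1,1], [7,7,6,6,4,2,1,1]])),
     (([6,1,1,1,1,1], [[5,2,2,1,1,1,1,1,1,1], [6,3,3,1,1,1,1,1,1], [6,5,2,2,1,1,1,1,1],
         [6,5,5,2,1,1,1,1], [7,6,3,3,2,1,1,1], [6,6,5,3,3,1,1,1], [7,5,5,4,3,2,1,1]]),
      ([5,2,2,1,1], [[4,3,1,1,1,1,1,1,1,1,1,1], [5,4,3,2,2,1,1,1], [7,4,4,2,1,1,1,1],
         [7,4,4,3,2,1,1,1], [7,5,4,3,2,2,1,1], [8,8,6,5,3,3,1,1,1], [8,8,7,5,4,2,2,1,1]])),
     (([5,5,1], [[5,2,2,2,2,1,1], [4,4,3,3,3,1], [5,4,4,4,3,2], [6,5,5,5,3,2,1]]),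
      ([3,3,3,2], [[7,1,1,1,1,1,1,1], [4,3,3,2,2,2], [4,4,4,4,3]])),
     (([5,4,2], [[7,2,1,1,1,1,1,1], [6,5,1,1,1,1,1,1], [6,3,3,3,1,1,1,1], [5,5,4,4,1,1,1],
         [6,5,5,2,2,2,1], [6,6,6,3,2,2,1]]),
      ([4,3,2,2], [[3,2,2,2,2,1,1,1], [4,3,3,3,1,1,1], [6,3,3,2,2,1,1], [7,6,5,5,2,1,1,1],
         [7,6,6,5,3,1,1,1]])),
     (([5,4,1,1], [[3,3,2,2,2,1,1], [6,3,2,2,2,1,1], [5,5,3,3,2,1,1], [8,8,7,6,4,3,1,1,1]]),
      ([4,4,3], [[6,2,1,1,1,1,1,1,1], [4,4,2,2,1,1,1,1,1], [6,4,2,2,2,2,1], [6,6,3,2,2,2,1]])),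
     (([5,3,2,1], [[5,3,2,2,1,1,1,1,1,1], [7,4,3,2,1,1,1,1], [6,5,3,3,2,2,1], [7,7,7,5,3,2,1,1]]),
      ([3,3,1,1,1,1,1], [[3,3,3,1,1,1,1,1,1], [5,3,3,2,2,1,1], [7,6,4,3,3,2,1,1]])),
     (([5,3,1,1,1], [[7,3,1,1,1,1,1,1], [5,4,2,2,2,1,1,1], [5,4,3,2,2,2,2], [6,5,5,2,2,1,1,1],
         [6,6,4,3,3,1,1,1], [6,6,5,4,3,1,1,1], [7,6,6,3,3,2,1,1]]),
      ([3,3,2,2,1], [[4,4,1,1,1,1,1,1,1,1], [6,5,2,1,1,1,1,1], [5,4,4,3,1,1,1,1],
         [5,5,4,3,2,1,1,1], [7,5,4,4,1,1,1,1], [6,6,5,3,2,2,2], [7,7,6,4,2,1,1,1]])),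
     (([5,2,2,2], [[5,3,1,1,1,1,1,1,1,1,1], [6,3,3,2,1,1,1,1,1], [5,5,4,2,2,1,1,1],
         [7,6,4,2,1,1,1,1], [7,6,5,2,2,1,1,1], [6,6,5,4,2,2,2], [7,7,5,5,2,2,1,1]]),
      ([5,2,1,1,1,1], [[4,2,2,2,1,1,1,1,1], [4,4,4,1,1,1,1,1], [5,4,2,2,2,2,2], [7,5,3,2,2,1,1,1],
         [7,5,5,2,2,1,1,1], [7,5,5,3,2,2,1,1], [8,8,6,5,3,3,2,1,1]])),
     (([5,1,1,1,1,1,1], [[4,4,2,1,1,1,1,1,1,1,1], [6,4,2,2,1,1,1,1,1,1], [5,5,4,3,1,1,1,1,1],
         [7,5,3,3,2,1,1,1,1], [7,6,5,3,1,1,1,1,1], [7,6,4,4,2,2,1,1,1], [7,7,5,4,2,2,1,1,1],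
         [7,7,5,5,3,2,1,1,1], [8,6,6,5,4,2,1,1,1], [8,7,6,4,4,3,2,1,1]]),
      ([4,2,1,1,1,1,1], [[4,3,2,1,1,1,1,1,1,1,1,1], [5,4,3,3,1,1,1,1,1], [7,5,3,2,1,1,1,1,1],
         [6,5,5,3,1,1,1,1,1], [6,6,4,4,2,1,1,1,1], [7,5,5,4,3,1,1,1,1], [7,6,6,4,3,1,1,1,1],
         [8,7,6,4,3,1,1,1,1], [8,7,6,4,3,2,2,1,1], [9,9,7,6,5,4,2,2,1,1]])),
     (([4,3,2,1,1], [[5,5,1,1,1,1,1,1], [4,4,4,3,1,1,1], [5,4,4,3,2,2]]),
      ([3,2,2,2,2], [[6,3,1,1,1,1,1,1,1], [4,4,4,2,2,2], [6,4,3,3,3,1,1], [5,5,5,5,3,2]])),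
     (([4,1,1,1,1,1,1,1], [[6,4,2,1,1,1,1,1,1,1], [5,4,4,2,1,1,1,1,1,1], [6,5,3,2,2,1,1,1,1,1],
         [6,6,4,3,1,1,1,1,1,1], [6,6,5,3,2,1,1,1,1,1], [7,6,5,3,2,2,1,1,1,1],
         [7,7,5,4,3,1,1,1,1,1], [8,6,5,5,3,2,1,1,1,1], [8,7,6,4,3,3,1,1,1,1],
         [8,7,6,5,3,3,2,1,1,1], [9,8,6,5,4,3,1,1,1,1], [9,7,7,6,4,3,2,1,1,1],
         [9,8,7,5,5,4,2,1,1,1], [9,8,7,6,5,3,3,2,1,1]]),
      ([2,2,2,1,1,1,1,1], [[5,3,2,1,1,1,1,1,1,1,1,1], [6,5,3,1,1,1,1,1,1,1],
         [6,4,4,3,1,1,1,1,1,1], [7,5,4,2,2,1,1,1,1,1], [7,5,4,4,2,1,1,1,1,1],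
         [7,6,4,4,3,1,1,1,1,1], [8,6,5,4,2,2,1,1,1,1], [7,7,6,4,3,2,1,1,1,1],
         [8,7,5,5,4,2,1,1,1,1], [9,7,6,5,4,2,1,1,1,1], [8,7,7,5,4,3,2,1,1,1],
         [9,8,6,5,5,3,2,1,1,1], [9,8,7,6,4,3,3,1,1,1], [9,9,7,6,5,4,2,1,1,1]])),
     (([3,2,2,2,1,1], [[4,4,3,2,1,1,1,1,1], [5,5,3,2,2,1,1,1], [6,5,3,2,2,2,2], [6,6,4,3,2,2,2],
         [7,7,5,3,2,2,1,1]]),
      ([2,2,2,2,1,1,1], [[6,4,1,1,1,1,1,1,1], [7,4,3,1,1,1,1,1], [6,4,3,2,2,2,2], [6,5,4,3,2,2,2],
         [7,5,5,4,2,2,1,1]])),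
     (([3,2,1,1,1,1,1,1], [[5,4,2,1,1,1,1,1,1,1,1,1], [5,5,3,2,1,1,1,1,1,1,1],
         [6,5,3,3,1,1,1,1,1,1,1], [7,5,4,3,1,1,1,1,1,1,1], [7,5,5,3,2,1,1,1,1,1,1],
         [7,6,5,3,3,1,1,1,1,1,1], [8,6,5,4,3,1,1,1,1,1,1], [8,6,6,4,3,2,1,1,1,1,1],
         [8,7,6,4,4,2,1,1,1,1,1], [8,7,6,5,4,2,2,1,1,1,1], [8,8,6,5,4,3,2,1,1,1,1],
         [9,8,6,6,4,3,2,1,1,1,1], [9,8,7,6,4,4,2,1,1,1,1], [9,8,7,6,5,4,2,2,1,1,1],
         [9,9,7,6,5,4,3,2,1,1,1], [10,9,7,7,5,4,3,2,1,1,1], [10,9,8,7,5,5,3,2,1,1,1],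
         [10,9,8,7,6,5,3,3,1,1,1], [10,10,8,7,6,5,4,3,1,1,1]]),
      ([3,1,1,1,1,1,1,1,1], [[5,3,3,1,1,1,1,1,1,1,1], [6,4,3,1,1,1,1,1,1,1,1],
         [6,4,4,2,1,1,1,1,1,1,1], [6,5,4,2,2,1,1,1,1,1,1], [6,6,4,3,2,1,1,1,1,1,1],
         [7,6,4,4,2,1,1,1,1,1,1], [7,6,5,4,2,2,1,1,1,1,1], [7,7,5,4,3,2,1,1,1,1,1],
         [8,7,5,5,3,2,1,1,1,1,1], [8,7,6,5,3,3,1,1,1,1,1], [9,7,6,5,4,3,1,1,1,1,1],
         [9,7,7,5,4,3,2,1,1,1,1], [9,8,7,5,5,3,2,1,1,1,1], [9,8,7,6,5,3,3,1,1,1,1],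
         [10,8,7,6,5,4,3,1,1,1,1], [10,8,8,6,5,4,3,2,1,1,1], [10,9,8,6,6,4,3,2,1,1,1],
         [10,9,8,7,6,4,4,2,1,1,1], [10,9,8,7,6,5,4,2,2,1,1]])),
     (([2,1,1,1,1,1,1,1,1,1], [[5,4,3,2,1,1,1,1,1,1,1,1], [6,5,3,2,1,1,1,1,1,1,1,1],
         [6,5,4,3,1,1,1,1,1,1,1,1], [7,5,4,3,2,1,1,1,1,1,1,1], [7,6,5,3,2,1,1,1,1,1,1,1],
         [7,6,5,4,3,1,1,1,1,1,1,1], [8,6,5,4,3,2,1,1,1,1,1,1], [8,7,6,4,3,2,1,1,1,1,1,1],
         [8,7,6,5,4,2,1,1,1,1,1,1], [8,7,6,5,4,3,2,1,1,1,1,1], [9,8,6,5,4,3,2,1,1,1,1,1],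
         [9,8,7,6,4,3,2,1,1,1,1,1], [9,8,7,6,5,4,2,1,1,1,1,1], [9,8,7,6,5,4,3,2,1,1,1,1],
         [10,9,7,6,5,4,3,2,1,1,1,1], [10,9,8,7,5,4,3,2,1,1,1,1], [10,9,8,7,6,5,3,2,1,1,1,1],
         [10,9,8,7,6,5,4,3,1,1,1,1], [11,9,8,7,6,5,4,3,2,1,1,1], [11,10,9,7,6,5,4,3,2,1,1,1],
         [11,10,9,8,7,5,4,3,2,1,1,1], [11,10,9,8,7,6,5,3,2,1,1,1], [11,10,9,8,7,6,5,4,3,1,1,1]]),
      ([1,1,1,1,1,1,1,1,1,1,1], [[5,4,3,1,1,1,1,1,1,1,1,1], [6,4,3,2,1,1,1,1,1,1,1,1],
         [6,5,4,2,1,1,1,1,1,1,1,1], [6,5,4,3,2,1,1,1,1,1,1,1], [7,6,4,3,2,1,1,1,1,1,1,1],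
         [7,6,5,4,2,1,1,1,1,1,1,1], [7,6,5,4,3,2,1,1,1,1,1,1], [8,7,5,4,3,2,1,1,1,1,1,1],
         [8,7,6,5,3,2,1,1,1,1,1,1], [8,7,6,5,4,3,1,1,1,1,1,1], [9,7,6,5,4,3,2,1,1,1,1,1],
         [9,8,7,5,4,3,2,1,1,1,1,1], [9,8,7,6,5,3,2,1,1,1,1,1], [9,8,7,6,5,4,3,1,1,1,1,1],
         [10,8,7,6,5,4,3,2,1,1,1,1], [10,9,8,6,5,4,3,2,1,1,1,1], [10,9,8,7,6,4,3,2,1,1,1,1],
         [10,9,8,7,6,5,4,2,1,1,1,1], [10,9,8,7,6,5,4,3,2,1,1,1], [11,10,8,7,6,5,4,3,2,1,1,1],
         [11,10,9,8,6,5,4,3,2,1,1,1], [11,10,9,8,7,6,4,3,2,1,1,1], [11,10,9,8,7,6,5,4,2,1,1,1]]))])"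

section \<open>Verification and the theorem\<close>

lemma table_ok_0: "table_ok 0 table0"
  by code_simp

lemma table_ok_1: "table_ok 1 table1"
  by code_simp

lemma table_ok_2: "table_ok 2 table2"
  by code_simp

lemma table_ok_3: "table_ok 3 table3"
  by code_simp

lemma table_ok_4: "table_ok 4 table4"
  by code_simp

lemma table_ok_5: "table_ok 5 table5"
  by code_simp

lemma table_ok_6: "table_ok 6 table6"
  by code_simp

lemma table_ok_7: "table_ok 7 table7"
  by code_simp

lemma table_ok_8: "table_ok 8 table8"
  by code_simp

lemma table_ok_9: "table_ok 9 table9"
  by code_simp

lemma table_ok_10: "table_ok 10 table10"
  by code_simp

lemma table_ok_11: "table_ok 11 table11"
  by code_simp

theorem mainTheorem3:
  fixes k :: nat
  assumes "k \<le> 11"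
  shows "\<exists>(C :: nat list \<Rightarrow> nat list set) (star :: nat list \<Rightarrow> nat list).
    (\<forall>\<mu>\<in>Par k. \<forall>\<gamma>\<in>C \<mu>. is_partition \<gamma>) \<and>
    (\<forall>\<mu>\<in>Par k. star \<mu> \<in> Par k \<and> star (star \<mu>) = \<mu>) \<and>
    disjoint_family_on C (Par k) \<and>
    (\<forall>\<mu>\<in>Par k. \<forall>\<gamma>\<in>C \<mu>. defc \<gamma> = int (psize \<mu>) \<and> psize \<mu> = k) \<and>
    (\<forall>\<mu>\<in>Par k. \<exists>c :: nat \<Rightarrow> nat list.
        C \<mu> = c ` {length (star \<mu>)..} \<and> (\<forall>i\<ge>length (star \<mu>). dinv (c i) = i)) \<and>
    (\<forall>\<gamma>\<in>Def k. \<exists>\<mu>\<in>Par k. \<gamma> \<in> C \<mu>) \<and>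
    (\<forall>\<mu>\<in>Par k. tail \<mu> \<subseteq> C \<mu>) \<and>
    (\<forall>\<mu>\<in>Par k. \<forall>\<gamma>\<in>C \<mu>. \<forall>\<delta>. nu \<gamma> = Some \<delta> \<longrightarrow> \<delta> \<in> C \<mu>) \<and>
    (\<forall>n. \<forall>\<mu>\<in>Par k. Cat n (C \<mu>) var_q var_t = Cat n (C (star \<mu>)) var_t var_q)"
proof -
  have "k = 0 \<or> k = 1 \<or> k = 2 \<or> k = 3 \<or> k = 4 \<or> k = 5 \<or>
      k = 6 \<or> k = 7 \<or> k = 8 \<or> k = 9 \<or> k = 10 \<or> k = 11"
    using assms by presburger
  then have "\<exists>T. table_ok k T"
    using table_ok_0 table_ok_1 table_ok_2 table_ok_3 table_ok_4 table_ok_5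
      table_ok_6 table_ok_7 table_ok_8 table_ok_9 table_ok_10 table_ok_11 by blast
  then show ?thesis using table_sound by blast
qed

end
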